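(* Let $r \ge 3$. There exists $t_0=t_0(r)$ such that for every integer $t\ge t_0$, every $r$-graph $G$ with $\binom{t}{r} - \binom{t-2}{r-2}$ edges satisfies $\lambda(G) \le \lambda([t-1]^{(r)})$.
   Context: An $r$-graph is a finite family of $r$-subsets of $\mathbb{N}$; $[t-1]^{(r)}$ is the complete $r$-graph consisting of all $r$-subsets of $\{1,\dots,t-1\}$. A weighting of $\mathbb{N}$ is $w:\mathbb{N}\to[0,\infty)$ with $\sum_x w(x)=1$; $w(G)=\sum_{e\in G}\prod_{x\in e}w(x)$; the Lagrangian is $\lambda(G)=\max_w w(G)$. *)

theory Defs
  imports Complex_Main
begin

definition r_graph :: "nat \<Rightarrow> nat set set \<Rightarrow> bool" where
  "r_graph r G \<longleftrightarrow> finite G \<and> (\<forall>e\<in>G. finite e \<and> card e = r)"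

definition complete_rgraph :: "nat \<Rightarrow> nat \<Rightarrow> nat set set" where
  "complete_rgraph r n = {e. e \<subseteq> {1..n} \<and> card e = r}"

definition weighting :: "(nat \<Rightarrow> real) \<Rightarrow> bool" where
  "weighting w \<longleftrightarrow> (\<forall>x. 0 \<le> w x) \<and> w sums 1"

definition wval :: "(nat \<Rightarrow> real) \<Rightarrow> nat set set \<Rightarrow> real" where
  "wval w G = (\<Sum>e\<in>G. \<Prod>x\<in>e. w x)"

text \<open>Lagrangian: the maximum (supremum; it is attained) of w(G) over weightings.\<close>
definition lagrangian :: "nat set set \<Rightarrow> real" where
  "lagrangian G = (SUP w\<in>{w. weighting w}. wval w G)"

end

theory Submission
  imports Defs "HOL-Library.Ramsey" "HOL-Analysis.Function_Topology"
begin

text \<open>Put \<open>n = t - 1\<close> and scale weights to total mass \<open>n\<close>, so that the claim becomes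
  \<open>u(G) \<le> binomial n r\<close>. Suppose a maximal weighting \<open>u\<close> violates it, and let \<open>V\<close> be its support.
  Comparing the number of edges, which is \<open>(1 + r/n) * binomial n r\<close>, with the entropy of the
  distribution on edges proportional to their weights shows that \<open>u\<close> has bounded variance around 1;
  then almost all weights exceed \<open>1/2\<close>, only \<open>O(n\<^sup>r\<^sup>-\<^sup>2)\<close> sets are non-edges, and \<open>V\<close> has at most \<open>n + 1\<close>
  vertices. If it has at most \<open>n\<close>, Maclaurin's inequality applies. If it has \<open>n + 1\<close>, let \<open>x\<close> and \<open>y\<close> be the
  lightest vertices. Moving the weight of \<open>y\<close> to \<open>x\<close> costs the complete graph on \<open>V\<close> exactly the
  weight of the \<open>binomial (n - 1) (r - 2)\<close> sets through \<open>x\<close> and \<open>y\<close>, and \<open>G\<close> misses at least as many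
  sets. Missing sets of another kind could be lighter only if the weights deviate from 1, and a
  quantitative form of Maclaurin's inequality makes that deviation more expensive than the gain.\<close>

section \<open>Weights of hypergraphs and elementary symmetric functions\<close>

text \<open>The scaling makes every edge of the uniform weighting weigh 1, where the entropy bound
  \<open>s * (1 - ln s) \<le> 1\<close> is sharp; the edge excess \<open>r / n\<close> then costs
  only a bounded amount. This bounds the variance in terms of \<open>S - n\<close>, with
  \<open>S\<close> the sum of squares. \<open>S\<close> itself is controlled by expanding e_r to
  second order: a large \<open>S\<close> would push e_r below \<open>binomial n r\<close>. The
  obstacle on \<open>n + 1\<close> vertices is that gain and cost have the same order. With E^2 the
  squared deviation after merging, stability pays about n^(r-2) E^2, while exchanging sets through
  the two lightest vertices for other non-edges can gain n^(r-2) E times the weight of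
  \<open>y\<close>, and a term linear in E is too big for small E. Two devices help. Up to a bounded
  number of exceptional vertices, weights deviate by at most \<open>e * E\<close>; sets with three
  exceptional vertices are fewer by one power of n. And whenever the exchange gains, the weight of
  \<open>y\<close> can be played against the deficits, which supplies the second factor E. The
  constant \<open>e\<close> is then taken small.\<close>

definition link :: "nat \<Rightarrow> nat set set \<Rightarrow> nat set set" where
  "link x F = {A. x \<notin> A \<and> insert x A \<in> F}"

lemma finite_link: "finite F \<Longrightarrow> finite (link x F)"
  by (rule finite_imageD[of "insert x"], rule finite_subset[of _ F])
     (auto simp: link_def inj_on_def)

lemma wval_nonneg: "(\<And>f i. f \<in> F \<Longrightarrow> i \<in> f \<Longrightarrow> 0 \<le> u i) \<Longrightarrow> 0 \<le> wval u F"
  unfolding wval_def by (intro sum_nonneg prod_nonneg) auto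

lemma wval_mono:
  assumes "finite F" "F' \<subseteq> F" "\<And>f i. f \<in> F \<Longrightarrow> i \<in> f \<Longrightarrow> 0 \<le> u i"
  shows "wval u F' \<le> wval u F"
  unfolding wval_def using assms by (intro sum_mono2) (auto intro!: prod_nonneg)

lemma wval_cong:
  assumes "\<And>f i. f \<in> F \<Longrightarrow> i \<in> f \<Longrightarrow> u i = v i"
  shows "wval u F = wval v F"
  unfolding wval_def using assms by (intro sum.cong prod.cong) auto

lemma wval_split: "finite F \<Longrightarrow> F' \<subseteq> F \<Longrightarrow> wval u F = wval u F' + wval u (F - F')"
  unfolding wval_def by (metis add.commute sum.subset_diff)

lemma wval_star:
  assumes "finite F" "\<And>f. f \<in> F \<Longrightarrow> finite f"
  shows "wval u {f\<in>F. x \<in> f} = u x * wval u (link x F)"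
proof -
  have "{f\<in>F. x \<in> f} = insert x ` link x F"
  proof (intro equalityI subsetI)
    fix f assume "f \<in> {f\<in>F. x \<in> f}"
    then have "f = insert x (f - {x})" "f - {x} \<in> link x F"
      by (auto simp: link_def insert_absorb)
    then show "f \<in> insert x ` link x F" by blast
  qed (auto simp: link_def)
  moreover have "inj_on (insert x) (link x F)"
    by (auto simp: link_def inj_on_def)
  ultimately have "wval u {f\<in>F. x \<in> f} = (\<Sum>A\<in>link x F. \<Prod>i\<in>insert x A. u i)"
    unfolding wval_def by (simp add: sum.reindex)
  also have "\<dots> = (\<Sum>A\<in>link x F. u x * (\<Prod>i\<in>A. u i))"
  proof (intro sum.cong refl)
    fix A assume "A \<in> link x F"
    then have "finite A" "x \<notin> A" using assms(2)[of "insert x A"] by (auto simp: link_def)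
    then show "(\<Prod>i\<in>insert x A. u i) = u x * (\<Prod>i\<in>A. u i)" by simp
  qed
  finally show ?thesis by (simp add: wval_def sum_distrib_left)
qed

text \<open>Linearity in \<open>u x\<close>: the weight of \<open>link x F\<close> is the partial
  derivative of the polynomial \<open>wval u F\<close> with respect to \<open>u x\<close>.\<close>

lemma wval_peel:
  assumes "finite F" "\<And>f. f \<in> F \<Longrightarrow> finite f"
  shows "wval u F = wval u {f\<in>F. x \<notin> f} + u x * wval u (link x F)"
proof -
  have "F - {f\<in>F. x \<notin> f} = {f\<in>F. x \<in> f}" by auto
  then show ?thesis
    using wval_split[of F "{f\<in>F. x \<notin> f}" u] wval_star[of F u x] assms by simp
qed

text \<open>Double counting of incidences. The factor \<open>g\<close> stays free:
  \<open>g = 1\<close> gives Euler's identity, a bound on \<open>ln (u i)\<close> gives the entropy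
  sum.\<close>

lemma sum_link:
  assumes "finite V" "\<And>f. f \<in> F \<Longrightarrow> f \<subseteq> V"
  shows "(\<Sum>f\<in>F. (\<Sum>i\<in>f. g i) * (\<Prod>i\<in>f. u i)) = (\<Sum>i\<in>V. g i * (u i * wval u (link i F)))"
proof -
  have finF: "finite F" using assms by (auto intro: finite_subset[of _ "Pow V"])
  have fin: "finite f" if "f \<in> F" for f using assms that finite_subset by blast
  have "(\<Sum>f\<in>F. (\<Sum>i\<in>f. g i) * (\<Prod>i\<in>f. u i)) = (\<Sum>f\<in>F. \<Sum>i\<in>V. if i \<in> f then g i * (\<Prod>i\<in>f. u i) else 0)"
  proof (intro sum.cong refl)
    fix f assume "f \<in> F"
    then have "f = {i\<in>V. i \<in> f}" using assms by auto
    then show "(\<Sum>i\<in>f. g i) * (\<Prod>i\<in>f. u i) = (\<Sum>i\<in>V. if i \<in> f then g i * (\<Prod>i\<in>f. u i) else 0)"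
      using assms(1) by (simp add: sum_distrib_right sum.If_cases Int_def)
  qed
  also have "\<dots> = (\<Sum>i\<in>V. \<Sum>f\<in>F. if i \<in> f then g i * (\<Prod>i\<in>f. u i) else 0)"
    by (rule sum.swap)
  also have "\<dots> = (\<Sum>i\<in>V. g i * (u i * wval u (link i F)))"
  proof (intro sum.cong refl)
    fix i
    have "(\<Sum>f\<in>F. if i \<in> f then g i * (\<Prod>i\<in>f. u i) else 0) = g i * wval u {f\<in>F. i \<in> f}"
      using finF by (simp add: sum.If_cases wval_def sum_distrib_left Int_def)
    then show "(\<Sum>f\<in>F. if i \<in> f then g i * (\<Prod>i\<in>f. u i) else 0) = g i * (u i * wval u (link i F))"
      using wval_star[OF finF fin] by simp
  qed
  finally show ?thesis .
qed

lemma wval_singleton_empty [simp]: "wval u {{}} = 1"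
  by (simp add: wval_def)

lemma wval_nsets_Suc_0 [simp]: "wval u ([V]\<^bsup>Suc 0\<^esup>) = sum u V"
proof -
  have "inj_on (\<lambda>x. {x}) V" by (auto simp: inj_on_def)
  then show ?thesis by (simp add: wval_def nsets_one sum.reindex)
qed

lemma wval_nsets_nonneg: "(\<And>i. i \<in> V \<Longrightarrow> 0 \<le> u i) \<Longrightarrow> 0 \<le> wval u ([V]\<^bsup>k\<^esup>)"
  by (rule wval_nonneg) (auto simp: nsets_def)

lemma link_nsets: "x \<in> V \<Longrightarrow> link x ([V]\<^bsup>Suc k\<^esup>) = [V - {x}]\<^bsup>k\<^esup>"
  by (auto simp: link_def nsets_def card_insert_if)

lemma card_nsets_finite: "finite V \<Longrightarrow> card ([V]\<^bsup>k\<^esup>) = card V choose k"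
proof -
  assume "finite V"
  then have "[V]\<^bsup>k\<^esup> = {B. B \<subseteq> V \<and> card B = k}" by (auto simp: nsets_def intro: finite_subset)
  with n_subsets[OF \<open>finite V\<close>] show ?thesis by simp
qed

text \<open>The weight of all k-subsets of \<open>V\<close> is the elementary symmetric polynomial
  e_k; this is its recursion in one variable.\<close>

lemma wval_nsets_peel:
  assumes "finite V" "x \<in> V"
  shows "wval u ([V]\<^bsup>Suc k\<^esup>) = wval u ([V - {x}]\<^bsup>Suc k\<^esup>) + u x * wval u ([V - {x}]\<^bsup>k\<^esup>)"
proof -
  have "{f \<in> [V]\<^bsup>Suc k\<^esup>. x \<notin> f} = [V - {x}]\<^bsup>Suc k\<^esup>" by (auto simp: nsets_def)
  moreover have "finite f" if "f \<in> [V]\<^bsup>Suc k\<^esup>" for f using that by (auto simp: nsets_def)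
  ultimately show ?thesis
    using wval_peel[of "[V]\<^bsup>Suc k\<^esup>" u x] assms by (simp add: link_nsets finite_imp_finite_nsets)
qed

lemma wval_euler:
  assumes "finite V" "\<And>f. f \<in> F \<Longrightarrow> f \<subseteq> V \<and> card f = k"
  shows "(\<Sum>i\<in>V. u i * wval u (link i F)) = k * wval u F"
proof -
  have "(\<Sum>i\<in>V. u i * wval u (link i F)) = (\<Sum>f\<in>F. (\<Sum>i\<in>f. 1) * (\<Prod>i\<in>f. u i))"
    using sum_link[of V F "\<lambda>_. 1" u] assms by simp
  also have "\<dots> = (\<Sum>f\<in>F. k * (\<Prod>i\<in>f. u i))"
    using assms by (intro sum.cong) auto
  finally show ?thesis by (simp add: wval_def sum_distrib_left)
qed

lemma wval_nsets_euler:
  assumes "finite V"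
  shows "(\<Sum>i\<in>V. u i * wval u ([V - {i}]\<^bsup>k\<^esup>)) = Suc k * wval u ([V]\<^bsup>Suc k\<^esup>)"
proof -
  have "(\<Sum>i\<in>V. u i * wval u ([V - {i}]\<^bsup>k\<^esup>)) = (\<Sum>i\<in>V. u i * wval u (link i ([V]\<^bsup>Suc k\<^esup>)))"
    by (intro sum.cong) (auto simp: link_nsets)
  also have "\<dots> = Suc k * wval u ([V]\<^bsup>Suc k\<^esup>)"
    by (rule wval_euler[OF assms]) (auto simp: nsets_def)
  finally show ?thesis .
qed

text \<open>Euler's identity, with e_(k+1) of \<open>V - {i}\<close> replaced by e_(k+1) of
  \<open>V\<close> minus \<open>u i\<close> times e_k of \<open>V - {i}\<close>. The squares are the
  source of the variance terms below.\<close>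

lemma wval_nsets_rec:
  assumes "finite V"
  shows "real (k + 2) * wval u ([V]\<^bsup>Suc (Suc k)\<^esup>) =
    sum u V * wval u ([V]\<^bsup>Suc k\<^esup>) - (\<Sum>i\<in>V. (u i)\<^sup>2 * wval u ([V - {i}]\<^bsup>k\<^esup>))"
proof -
  have "real (k + 2) * wval u ([V]\<^bsup>Suc (Suc k)\<^esup>) = (\<Sum>i\<in>V. u i * wval u ([V - {i}]\<^bsup>Suc k\<^esup>))"
    using wval_nsets_euler[OF assms, of u "Suc k"] by simp
  also have "\<dots> = (\<Sum>i\<in>V. u i * wval u ([V]\<^bsup>Suc k\<^esup>) - (u i)\<^sup>2 * wval u ([V - {i}]\<^bsup>k\<^esup>))"
    using wval_nsets_peel[OF assms] by (intro sum.cong) (auto simp: algebra_simps power2_eq_square)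
  finally show ?thesis by (simp add: sum_subtractf sum_distrib_right)
qed

lemma wval_nsets_2:
  assumes "finite V"
  shows "2 * wval u ([V]\<^bsup>2\<^esup>) = (sum u V)\<^sup>2 - (\<Sum>i\<in>V. (u i)\<^sup>2)"
  using wval_nsets_rec[OF assms, of 0 u] by (simp add: numeral_2_eq_2 power2_eq_square)

lemma wval_nsets_Suc_le:
  assumes "finite V" "\<And>i. i \<in> V \<Longrightarrow> 0 \<le> u i"
  shows "real (Suc k) * wval u ([V]\<^bsup>Suc k\<^esup>) \<le> sum u V * wval u ([V]\<^bsup>k\<^esup>)"
proof (cases k)
  case 0
  then show ?thesis by simp
next
  case (Suc j)
  have "0 \<le> (\<Sum>i\<in>V. (u i)\<^sup>2 * wval u ([V - {i}]\<^bsup>j\<^esup>))"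
    using assms by (intro sum_nonneg mult_nonneg_nonneg wval_nsets_nonneg) auto
  with wval_nsets_rec[OF assms(1), of j u] Suc show ?thesis by simp
qed

lemma wval_nsets_le_power:
  assumes "finite V" "\<And>i. i \<in> V \<Longrightarrow> 0 \<le> u i"
  shows "fact k * wval u ([V]\<^bsup>k\<^esup>) \<le> (sum u V) ^ k"
proof (induction k)
  case (Suc k)
  have "fact (Suc k) * wval u ([V]\<^bsup>Suc k\<^esup>) = fact k * (real (Suc k) * wval u ([V]\<^bsup>Suc k\<^esup>))"
    by (simp add: algebra_simps)
  also have "\<dots> \<le> fact k * (sum u V * wval u ([V]\<^bsup>k\<^esup>))"
    using wval_nsets_Suc_le[OF assms, where k=k] by (intro mult_left_mono) auto
  also have "\<dots> = sum u V * (fact k * wval u ([V]\<^bsup>k\<^esup>))" by simp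
  also have "\<dots> \<le> sum u V * (sum u V) ^ k"
    using Suc assms by (intro mult_left_mono sum_nonneg) auto
  finally show ?case by simp
qed simp

section \<open>Maclaurin's inequality and its stability\<close>

lemma sum_mult_sum_le_Chebyshev:
  fixes a b :: "'a \<Rightarrow> real"
  assumes "\<And>i j. i \<in> V \<Longrightarrow> j \<in> V \<Longrightarrow> 0 \<le> (a i - a j) * (b i - b j)"
  shows "sum a V * sum b V \<le> card V * (\<Sum>i\<in>V. a i * b i)"
proof -
  have "0 \<le> (\<Sum>i\<in>V. \<Sum>j\<in>V. (a i - a j) * (b i - b j))"
    using assms by (intro sum_nonneg) auto
  also have "\<dots> = (\<Sum>i\<in>V. \<Sum>j\<in>V. a i * b i + a j * b j - a i * b j - a j * b i)"
    by (simp add: algebra_simps)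
  also have "\<dots> = 2 * (card V * (\<Sum>i\<in>V. a i * b i)) - 2 * (sum a V * sum b V)"
    by (simp add: sum.distrib sum_subtractf mult.commute flip: sum_distrib_left sum_distrib_right)
  finally show ?thesis by simp
qed

text \<open>Chebyshev applies because \<open>u i * e\<^sub>k(V - {i})\<close> increases with \<open>u i\<close>: the difference for
  \<open>i\<close> and \<open>j\<close> is \<open>(u i - u j) * e\<^sub>k(V - {i, j})\<close>.\<close>
lemma maclaurin_step:
  assumes "finite V" "\<And>i. i \<in> V \<Longrightarrow> 0 \<le> u i" "sum u V = real (card V)" "k < card V"
  shows "real (Suc k) * wval u ([V]\<^bsup>Suc k\<^esup>) \<le> (real (card V) - k) * wval u ([V]\<^bsup>k\<^esup>)"
proof (cases k)
  case 0
  then show ?thesis using assms by simp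
next
  case (Suc j)
  define b where "b i = u i * wval u ([V - {i}]\<^bsup>j\<^esup>)" for i
  have mono: "0 \<le> (u i - u l) * (b i - b l)" if il: "i \<in> V" "l \<in> V" for i l
  proof (cases "i = l")
    case False
    have "b i - b l = (u i - u l) * wval u ([V - {i, l}]\<^bsup>j\<^esup>)"
    proof (cases j)
      case (Suc m)
      have e: "V - {i} - {l} = V - {i, l}" "V - {l} - {i} = V - {i, l}" by auto
      show ?thesis
        using wval_nsets_peel[of "V - {i}" l u m] wval_nsets_peel[of "V - {l}" i u m] il False assms(1)
        by (simp add: b_def Suc e algebra_simps)
    qed (simp add: b_def)
    then have "(u i - u l) * (b i - b l) = (u i - u l)\<^sup>2 * wval u ([V - {i, l}]\<^bsup>j\<^esup>)"
      by (simp add: power2_eq_square)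
    moreover have "0 \<le> wval u ([V - {i, l}]\<^bsup>j\<^esup>)"
      using assms(2) by (intro wval_nsets_nonneg) auto
    ultimately show ?thesis by simp
  qed simp
  have "sum u V * sum b V \<le> card V * (\<Sum>i\<in>V. u i * b i)"
    by (rule sum_mult_sum_le_Chebyshev[OF mono])
  then have "sum b V \<le> (\<Sum>i\<in>V. u i * b i)"
    using assms(3,4) by simp
  moreover have "sum b V = k * wval u ([V]\<^bsup>k\<^esup>)"
    unfolding b_def using wval_nsets_euler[OF assms(1), of u j] Suc by simp
  moreover have "(\<Sum>i\<in>V. u i * b i) = (\<Sum>i\<in>V. (u i)\<^sup>2 * wval u ([V - {i}]\<^bsup>j\<^esup>))"
    by (simp add: b_def power2_eq_square algebra_simps)
  ultimately show ?thesis
    using wval_nsets_rec[OF assms(1), of j u] assms(3) Suc by (simp add: algebra_simps)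
qed

text \<open>The ratio allowed by \<open>maclaurin_step\<close> is that of consecutive binomials, so
  the steps telescope. The start \<open>j\<close> stays free because stability compares with
  \<open>j = 2\<close>.\<close>

lemma maclaurin:
  assumes "finite V" "\<And>i. i \<in> V \<Longrightarrow> 0 \<le> u i" "sum u V = real (card V)" "j \<le> k" "k \<le> card V"
  shows "wval u ([V]\<^bsup>k\<^esup>) * (card V choose j) \<le> wval u ([V]\<^bsup>j\<^esup>) * (card V choose k)"
  using assms(4,5)
proof (induction k rule: dec_induct)
  case (step k)
  let ?n = "card V" and ?e = "\<lambda>k. wval u ([V]\<^bsup>k\<^esup>)"
  have k: "k < ?n" using step by simp
  have bin: "real (Suc k) * (?n choose Suc k) = (real ?n - k) * (?n choose k)"
    using binomial_absorption[of k ?n] binomial_absorb_comp[of ?n k] k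
    by (metis of_nat_diff of_nat_mult less_imp_le)
  have "real (Suc k) * (?e (Suc k) * (?n choose j)) \<le> (real ?n - k) * ?e k * (?n choose j)"
    using mult_right_mono[OF maclaurin_step[OF assms(1-3) k], of "?n choose j"] by (simp add: mult.assoc)
  also have "\<dots> \<le> (real ?n - k) * (?e j * (?n choose k))"
    using mult_left_mono[OF step.IH, of "real ?n - k"] k by (simp add: mult.assoc)
  also have "\<dots> = real (Suc k) * (?e j * (?n choose Suc k))"
    using bin by (metis mult.assoc mult.commute)
  finally show ?case by (simp add: mult_le_cancel_left_pos)
qed simp

text \<open>The comparison is with e_2, which sees the variance exactly: with n vertices, twice e_2
  is \<open>n * (n - 1)\<close> minus the squared deviation.\<close>

lemma maclaurin_stability:
  assumes "finite V" "\<And>i. i \<in> V \<Longrightarrow> 0 \<le> u i" "sum u V = real (card V)" "2 \<le> k" "k \<le> card V"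
  shows "wval u ([V]\<^bsup>k\<^esup>) \<le> (card V choose k) *
    (1 - (\<Sum>i\<in>V. (u i - 1)\<^sup>2) / (real (card V) * (real (card V) - 1)))"
proof -
  let ?n = "real (card V)" and ?D = "\<Sum>i\<in>V. (u i - 1)\<^sup>2"
  have n: "?n \<ge> 2" using assms by linarith
  have c2: "2 * real (card V choose 2) = ?n * (?n - 1)"
  proof -
    have "2 * (card V choose 2) = card V * (card V - 1)"
      using binomial_absorption[of 1 "card V"] by (simp add: numeral_2_eq_2)
    then have "real (2 * (card V choose 2)) = real (card V * (card V - 1))"
      by (rule arg_cong)
    then show ?thesis using n by (simp add: of_nat_diff)
  qed
  have "?D = (\<Sum>i\<in>V. (u i)\<^sup>2) - ?n"
    using assms(3) by (simp add: power2_diff sum.distrib sum_subtractf flip: sum_distrib_left)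
  then have e2: "2 * wval u ([V]\<^bsup>2\<^esup>) = ?n * (?n - 1) - ?D"
    using wval_nsets_2[OF assms(1), of u] assms(3) by (simp add: power2_eq_square algebra_simps)
  have "wval u ([V]\<^bsup>k\<^esup>) * (?n * (?n - 1)) \<le> (?n * (?n - 1) - ?D) * (card V choose k)"
    using maclaurin[OF assms(1-5)] unfolding c2[symmetric] e2[unfolded c2[symmetric], symmetric]
    by simp
  then show ?thesis using n by (simp add: field_simps)
qed

section \<open>Maximal weightings and Lagrange multipliers\<close>

text \<open>Coordinates outside \<open>W\<close> are pinned to 0, so that for finite
  \<open>W\<close> the set is compact in the product topology on all functions.\<close>

definition simplex :: "nat set \<Rightarrow> real \<Rightarrow> (nat \<Rightarrow> real) set" where
  "simplex W s = {u. (\<forall>x. 0 \<le> u x) \<and> (\<forall>x. x \<notin> W \<longrightarrow> u x = 0) \<and> sum u W = s}"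

lemma compact_simplex:
  assumes "finite W"
  shows "compact (simplex W s)"
proof -
  define K where "K = PiE UNIV (\<lambda>x. if x \<in> W then {0..s} else {0::real})"
  have "compactin (product_topology (\<lambda>_. euclidean) (UNIV :: nat set)) K"
    unfolding K_def by (subst compactin_PiE) auto
  then have K: "compact K" by (simp add: euclidean_product_topology)
  have "closed {u :: nat \<Rightarrow> real. sum u W = s}"
    by (intro closed_Collect_eq continuous_intros continuous_on_product_coordinates)
  moreover have "simplex W s = K \<inter> {u. sum u W = s}"
  proof (intro equalityI subsetI)
    fix u assume u: "u \<in> simplex W s"
    have "u x \<le> s" if "x \<in> W" for x
      using u that assms member_le_sum[of x W u] by (auto simp: simplex_def)
    with u show "u \<in> K \<inter> {u. sum u W = s}"
      by (auto simp: simplex_def K_def PiE_def Pi_def extensional_def)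
  next
    fix u assume u: "u \<in> K \<inter> {u. sum u W = s}"
    have "0 \<le> u x \<and> (x \<notin> W \<longrightarrow> u x = 0)" for x
    proof -
      have "u x \<in> (if x \<in> W then {0..s} else {0})" using u unfolding K_def by blast
      then show ?thesis by (auto split: if_splits)
    qed
    with u show "u \<in> simplex W s" by (auto simp: simplex_def)
  qed
  ultimately show ?thesis using K by (simp add: compact_Int_closed)
qed

lemma wval_attains_sup:
  assumes "finite W" "simplex W s \<noteq> {}"
  obtains u where "u \<in> simplex W s" "\<And>v. v \<in> simplex W s \<Longrightarrow> wval v F \<le> wval u F"
proof -
  have "continuous_on (simplex W s) (\<lambda>u. wval u F)"
    unfolding wval_def
    by (intro continuous_intros continuous_on_subset[OF continuous_on_product_coordinates]) auto
  from continuous_attains_sup[OF compact_simplex[OF assms(1)] assms(2) this] that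
  show thesis by blast
qed

text \<open>The polynomial is affine in each coordinate. The coefficients are fixed before
  \<open>v\<close>, so they serve a maximiser and its perturbation alike, and both links share the
  mixed coefficient \<open>d\<close>.\<close>

lemma wval_two_coordinates:
  assumes "finite F" "\<And>f. f \<in> F \<Longrightarrow> finite f" "x \<noteq> z"
  obtains a p q d where
    "\<And>v. (\<And>i. i \<noteq> x \<Longrightarrow> i \<noteq> z \<Longrightarrow> v i = u i) \<Longrightarrow>
       wval v F = a + v x * p + v z * q + v x * v z * d \<and>
       wval v (link x F) = p + v z * d \<and> wval v (link z F) = q + v x * d"
proof
  fix v assume v: "\<And>i. i \<noteq> x \<Longrightarrow> i \<noteq> z \<Longrightarrow> v i = u i"
  let ?F0 = "{f\<in>F. x \<notin> f}" and ?L = "link x F"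
  have fL: "finite ?L" "finite (link z F)" using assms by (auto intro: finite_link)
  have fin: "finite A" if "A \<in> link y F" for A y
    using assms(2)[of "insert y A"] that by (auto simp: link_def)
  have e1: "wval v F = wval v ?F0 + v x * wval v ?L"
    using wval_peel assms by blast
  have e2: "wval v ?F0 = wval v {f\<in>?F0. z \<notin> f} + v z * wval v (link z ?F0)"
    using assms by (intro wval_peel) auto
  have e3: "wval v ?L = wval v {f\<in>?L. z \<notin> f} + v z * wval v (link z ?L)"
    using fL fin by (intro wval_peel) auto
  have "wval v (link z F) = wval v {f\<in>link z F. x \<notin> f} + v x * wval v (link x (link z F))"
    using fL fin by (intro wval_peel) auto
  moreover have "{f\<in>link z F. x \<notin> f} = link z ?F0" "link x (link z F) = link z ?L"
    using assms(3) by (auto simp: link_def insert_commute)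
  ultimately have e4: "wval v (link z F) = wval v (link z ?F0) + v x * wval v (link z ?L)"
    by simp
  have c: "wval v {f\<in>?F0. z \<notin> f} = wval u {f\<in>?F0. z \<notin> f}"
    "wval v (link z ?F0) = wval u (link z ?F0)"
    "wval v {f\<in>?L. z \<notin> f} = wval u {f\<in>?L. z \<notin> f}"
    "wval v (link z ?L) = wval u (link z ?L)"
    by ((intro wval_cong v; auto simp: link_def)+)
  show "wval v F = wval u {f\<in>?F0. z \<notin> f} + v x * wval u {f\<in>?L. z \<notin> f} +
      v z * wval u (link z ?F0) + v x * v z * wval u (link z ?L) \<and>
      wval v ?L = wval u {f\<in>?L. z \<notin> f} + v z * wval u (link z ?L) \<and>
      wval v (link z F) = wval u (link z ?F0) + v x * wval u (link z ?L)"
    using e1 e2 e3 e4 c by (simp add: algebra_simps)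
qed

text \<open>Moving mass \<open>t\<close> from \<open>x\<close> to \<open>z\<close> changes the value
  by \<open>t\<close> times the difference of the links minus \<open>t^2 * d\<close>; for small
  \<open>t\<close> this is positive if the link of \<open>z\<close> is heavier. Positive weight at
  \<open>x\<close> allows the move.\<close>

lemma wval_link_le_of_max:
  assumes "finite F" "\<And>f. f \<in> F \<Longrightarrow> finite f" "finite W" "u \<in> simplex W s"
    and max: "\<And>v. v \<in> simplex W s \<Longrightarrow> wval v F \<le> wval u F"
    and x: "x \<in> W" "0 < u x" and z: "z \<in> W"
  shows "wval u (link z F) \<le> wval u (link x F)"
proof (cases "x = z")
  case False
  obtain a p q d where dec: "\<And>v. (\<And>i. i \<noteq> x \<Longrightarrow> i \<noteq> z \<Longrightarrow> v i = u i) \<Longrightarrow>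
       wval v F = a + v x * p + v z * q + v x * v z * d \<and>
       wval v (link x F) = p + v z * d \<and> wval v (link z F) = q + v x * d"
    using wval_two_coordinates[OF assms(1,2) False] by metis
  let ?D = "wval u (link z F) - wval u (link x F)"
  have bound: "?D \<le> t * d" if t: "0 < t" "t \<le> u x" for t
  proof -
    define v where "v = u(x := u x - t, z := u z + t)"
    have "sum v W = sum u W"
    proof -
      have "sum v W = v x + (v z + sum v (W - {x} - {z}))"
        using assms(3) x z False by (simp add: sum.remove[of W x] sum.remove[of "W - {x}" z])
      also have "sum v (W - {x} - {z}) = sum u (W - {x} - {z})"
        by (intro sum.cong) (auto simp: v_def)
      also have "v x + (v z + sum u (W - {x} - {z})) = sum u W"
        using assms(3) x z False by (simp add: v_def sum.remove[of W x] sum.remove[of "W - {x}" z])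
      finally show ?thesis .
    qed
    then have "v \<in> simplex W s" using assms(4) t x z by (auto simp: simplex_def v_def)
    then have "wval v F \<le> wval u F" by (rule max)
    moreover have "wval v F = wval u F + t * ?D - t * (t * d)"
      using dec[of v] dec[of u] False by (simp add: v_def algebra_simps)
    ultimately have "t * ?D \<le> t * (t * d)" by linarith
    then show ?thesis using t(1) by (simp add: mult_le_cancel_left_pos)
  qed
  show ?thesis
  proof (rule ccontr)
    assume "\<not> ?thesis"
    then have D: "0 < ?D" by simp
    with bound[of "u x"] x have d: "0 < d"
      by (smt (verit) mult_nonneg_nonpos)
    define t where "t = min (u x) (?D / (2 * d))"
    have "0 < t" "t \<le> u x" "t * d \<le> ?D / 2"
      using x D d by (auto simp: t_def min_def field_simps)
    then have "?D \<le> ?D / 2" using bound order_trans by blast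
    with D show False by simp
  qed
qed simp

text \<open>With all weights positive, mass can move in both directions, so all links weigh the
  same; Euler's identity gives the common value.\<close>

lemma wval_link_eq_of_max:
  assumes "finite F" "\<And>f. f \<in> F \<Longrightarrow> f \<subseteq> V \<and> card f = k" "finite V" "u \<in> simplex V s"
    and max: "\<And>v. v \<in> simplex V s \<Longrightarrow> wval v F \<le> wval u F"
    and pos: "\<And>i. i \<in> V \<Longrightarrow> 0 < u i" and x: "x \<in> V"
  shows "s * wval u (link x F) = k * wval u F"
proof -
  have fin: "\<And>f. f \<in> F \<Longrightarrow> finite f" using assms(2,3) finite_subset by blast
  have "wval u (link i F) = wval u (link x F)" if "i \<in> V" for i
    using wval_link_le_of_max[OF assms(1) fin assms(3,4) max] that pos x by (metis order_antisym)
  then have "(\<Sum>i\<in>V. u i * wval u (link i F)) = (\<Sum>i\<in>V. u i * wval u (link x F))"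
    by (intro sum.cong) auto
  also have "\<dots> = s * wval u (link x F)"
    using assms(4) by (simp add: simplex_def flip: sum_distrib_right)
  finally show ?thesis using wval_euler[OF assms(3,2), of F u] by simp
qed

text \<open>The falling factorial n(n-1)...(n-k), whose first correction has the coefficient 0 + 1 +
  ... + k. For \<open>n \<le> k\<close> the left-hand side is at most 0.\<close>

lemma binomial_lower_bound:
  "real n ^ Suc k - real (Suc k choose 2) * real n ^ k \<le> fact (Suc k) * real (n choose Suc k)"
proof (induction k)
  case (Suc k)
  have c: "Suc (Suc k) choose 2 = Suc k + (Suc k choose 2)"
    by (simp add: numeral_2_eq_2)
  show ?case
  proof (cases "n \<le> Suc k")
    case True
    then have "real n \<le> real (Suc (Suc k) choose 2)" unfolding c by linarith
    then have "real n * real n ^ Suc k \<le> real (Suc (Suc k) choose 2) * real n ^ Suc k"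
      by (intro mult_right_mono) auto
    then have "real n ^ Suc (Suc k) - real (Suc (Suc k) choose 2) * real n ^ Suc k \<le> 0"
      by simp
    also have "0 \<le> fact (Suc (Suc k)) * real (n choose Suc (Suc k))" by simp
    finally show ?thesis .
  next
    case False
    have "real (Suc (Suc k)) * (n choose Suc (Suc k)) = (real n - real (Suc k)) * (n choose Suc k)"
      using binomial_absorption[of "Suc k" n] binomial_absorb_comp[of n "Suc k"] False
      by (metis of_nat_diff of_nat_mult not_le less_imp_le)
    then have "fact (Suc (Suc k)) * real (n choose Suc (Suc k))
        = (real n - real (Suc k)) * (fact (Suc k) * real (n choose Suc k))"
      by (metis fact_Suc mult.assoc mult.commute of_nat_fact of_nat_mult)
    also have "\<dots> \<ge> (real n - real (Suc k)) * (real n ^ Suc k - real (Suc k choose 2) * real n ^ k)"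
      using False by (intro mult_left_mono Suc.IH) auto
    also have "(real n - real (Suc k)) * (real n ^ Suc k - real (Suc k choose 2) * real n ^ k)
       = real n ^ Suc (Suc k) - real (Suc (Suc k) choose 2) * real n ^ Suc k
         + real (Suc k) * real (Suc k choose 2) * real n ^ k"
      unfolding c by (simp add: algebra_simps)
    finally show ?thesis
      by (smt (verit) mult_nonneg_nonneg of_nat_0_le_iff zero_le_power)
  qed
qed simp

section \<open>Expansion of the elementary symmetric functions\<close>

text \<open>Each such set is a \<open>j\<close>-subset of \<open>T\<close> joined to
  \<open>r - j\<close> points of \<open>V\<close>; a bounded \<open>T\<close> thus saves
  \<open>j\<close> powers of \<open>card V\<close>.\<close>

lemma card_nsets_meeting:
  assumes "finite V" "finite T"
  shows "card {f \<in> [V]\<^bsup>r\<^esup>. j \<le> card (f \<inter> T)} \<le> (card T choose j) * (card V choose (r - j))"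
proof -
  have "{f \<in> [V]\<^bsup>r\<^esup>. j \<le> card (f \<inter> T)} \<subseteq> (\<lambda>(S, A). S \<union> A) ` ([T]\<^bsup>j\<^esup> \<times> [V]\<^bsup>(r - j)\<^esup>)"
  proof
    fix f assume f: "f \<in> {f \<in> [V]\<^bsup>r\<^esup>. j \<le> card (f \<inter> T)}"
    then obtain S where S: "S \<subseteq> f \<inter> T" "card S = j" "finite S"
      using obtain_subset_with_card_n by blast
    have "f - S \<in> [V]\<^bsup>(r - j)\<^esup>" using f S by (auto simp: nsets_def card_Diff_subset)
    moreover have "S \<in> [T]\<^bsup>j\<^esup>" using S by (auto simp: nsets_def)
    moreover have "f = S \<union> (f - S)" using S by auto
    ultimately show "f \<in> (\<lambda>(S, A). S \<union> A) ` ([T]\<^bsup>j\<^esup> \<times> [V]\<^bsup>(r - j)\<^esup>)"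
      by (metis (no_types, lifting) SigmaI image_eqI case_prod_conv)
  qed
  then have "card {f \<in> [V]\<^bsup>r\<^esup>. j \<le> card (f \<inter> T)} \<le> card ([T]\<^bsup>j\<^esup> \<times> [V]\<^bsup>(r - j)\<^esup>)"
    using assms by (intro surj_card_le) (auto simp: finite_imp_finite_nsets)
  also have "\<dots> = (card T choose j) * (card V choose (r - j))"
    by (simp add: card_cartesian_product card_nsets_finite[OF assms(1)] card_nsets_finite[OF assms(2)])
  finally show ?thesis .
qed

text \<open>Writing \<open>ln t = 2 * ln (sqrt t)\<close> before applying the tangent at 1 keeps the
  loss \<open>(sqrt t - 1)^2\<close>; the bound on \<open>t\<close> turns it into a multiple of
  \<open>(t - 1)^2\<close>.\<close>

lemma ln_le_quadratic:
  assumes "0 < t" "t \<le> C"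
  shows "ln t \<le> (t - 1) - (t - 1)\<^sup>2 / (sqrt C + 1)\<^sup>2"
proof -
  define s where "s = sqrt t"
  have s: "0 < s" "s \<le> sqrt C" "t = s\<^sup>2" using assms by (auto simp: s_def)
  have "ln t = 2 * ln s" using s by (simp add: ln_realpow)
  also have "\<dots> \<le> 2 * (s - 1)" using ln_le_minus_one[OF s(1)] by simp
  also have "\<dots> = (t - 1) - (s - 1)\<^sup>2" by (simp add: s(3) power2_eq_square algebra_simps)
  also have "\<dots> \<le> (t - 1) - (t - 1)\<^sup>2 / (sqrt C + 1)\<^sup>2"
  proof -
    have "(t - 1)\<^sup>2 = (s - 1)\<^sup>2 * (s + 1)\<^sup>2" by (simp add: s(3) power2_eq_square algebra_simps)
    also have "\<dots> \<le> (s - 1)\<^sup>2 * (sqrt C + 1)\<^sup>2"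
      using s by (intro mult_left_mono power_mono) auto
    finally have "(t - 1)\<^sup>2 / (sqrt C + 1)\<^sup>2 \<le> (s - 1)\<^sup>2"
      using s by (simp add: divide_le_eq)
    then show ?thesis by simp
  qed
  finally show ?thesis .
qed

lemma prod_log_bound:
  assumes "\<And>i. i \<in> f \<Longrightarrow> 0 < u i" "\<And>i. i \<in> f \<Longrightarrow> ln (u i) \<le> g i"
  shows "(\<Prod>i\<in>f. u i) * (1 - (\<Sum>i\<in>f. g i)) \<le> (1 :: real)"
proof -
  let ?p = "\<Prod>i\<in>f. u i"
  have p: "0 < ?p" using assms(1) by (intro prod_pos) auto
  have "ln ?p = (\<Sum>i\<in>f. ln (u i))"
  proof (cases "finite f")
    case True
    then show ?thesis using assms(1) by (intro ln_prod) force+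
  qed simp
  also have "\<dots> \<le> (\<Sum>i\<in>f. g i)" using assms(2) by (intro sum_mono) auto
  finally have "1 - (\<Sum>i\<in>f. g i) \<le> 1 - ln ?p" by simp
  also have "\<dots> \<le> inverse ?p"
    using ln_le_minus_one[of "inverse ?p"] p by (simp add: ln_inverse)
  finally have "?p * (1 - (\<Sum>i\<in>f. g i)) \<le> ?p * inverse ?p"
    using p by (intro mult_left_mono) auto
  then show ?thesis using p by simp
qed

text \<open>\<open>K\<close> depends only on \<open>C\<close> and \<open>k\<close>: bounded weights
  make the squares in the recursion sum to at most \<open>C * n\<close>, one power of
  \<open>n\<close> below the main term.\<close>

lemma wval_nsets_lower:
  assumes "0 \<le> C"
  shows "\<exists>K\<ge>0. \<forall>V u n. finite V \<and> (\<forall>i\<in>V. 0 \<le> u i \<and> u i \<le> C) \<and> sum u V = n \<longrightarrow>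
    n ^ Suc k / fact (Suc k) - K * n ^ k \<le> wval u ([V]\<^bsup>Suc k\<^esup>)"
proof (induction k)
  case 0
  show ?case
  proof (rule exI[of _ 0], intro conjI allI impI)
    fix V and u :: "nat \<Rightarrow> real" and n
    assume "finite V \<and> (\<forall>i\<in>V. 0 \<le> u i \<and> u i \<le> C) \<and> sum u V = n"
    then have "sum u V = n" by (elim conjE)
    then show "n ^ Suc 0 / fact (Suc 0) - 0 * n ^ 0 \<le> wval u ([V]\<^bsup>Suc 0\<^esup>)"
      unfolding wval_nsets_Suc_0 by simp
  qed (rule order_refl)
next
  case (Suc k)
  obtain K where K': "0 \<le> K \<and> (\<forall>V u n. finite V \<and> (\<forall>i\<in>V. 0 \<le> u i \<and> u i \<le> C) \<and> sum u V = n \<longrightarrow>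
      n ^ Suc k / fact (Suc k) - K * n ^ k \<le> wval u ([V]\<^bsup>Suc k\<^esup>))"
    using Suc.IH by (rule exE)
  note K = conjunct1[OF K'] and IH = conjunct2[OF K', rule_format]
  show ?case
  proof (rule exI[of _ "K + C"], intro conjI allI impI)
    fix V and u :: "nat \<Rightarrow> real" and n
    assume h: "finite V \<and> (\<forall>i\<in>V. 0 \<le> u i \<and> u i \<le> C) \<and> sum u V = n"
    then have a: "finite V" "\<forall>i\<in>V. 0 \<le> u i \<and> u i \<le> C" "sum u V = n" by auto
    have n: "0 \<le> n" using a by (metis sum_nonneg)
    have ek: "wval u ([V - {i}]\<^bsup>k\<^esup>) \<le> n ^ k" if "i \<in> V" for i
    proof -
      have "wval u ([V - {i}]\<^bsup>k\<^esup>) \<le> wval u ([V]\<^bsup>k\<^esup>)"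
        using a by (intro wval_mono finite_imp_finite_nsets nsets_mono) (auto simp: nsets_def)
      also have "\<dots> \<le> fact k * wval u ([V]\<^bsup>k\<^esup>)"
        using a wval_nsets_nonneg[of V u k] fact_ge_1[of k] mult_right_mono[of 1 "fact k :: real"] by fastforce
      also have "\<dots> \<le> n ^ k" using wval_nsets_le_power[of V u k] a by auto
      finally show ?thesis .
    qed
    have "(\<Sum>i\<in>V. (u i)\<^sup>2 * wval u ([V - {i}]\<^bsup>k\<^esup>)) \<le> (\<Sum>i\<in>V. (C * u i) * n ^ k)"
      using a n ek assms by (intro sum_mono mult_mono)
        (auto simp: power2_eq_square intro!: mult_mono wval_nsets_nonneg)
    also have "\<dots> = C * n ^ Suc k"
      using a by (simp add: sum_distrib_left[symmetric] sum_distrib_right[symmetric])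
    finally have 1: "(\<Sum>i\<in>V. (u i)\<^sup>2 * wval u ([V - {i}]\<^bsup>k\<^esup>)) \<le> C * n ^ Suc k" .
    have "n * (n ^ Suc k / fact (Suc k) - K * n ^ k) \<le> n * wval u ([V]\<^bsup>Suc k\<^esup>)"
      using IH[OF h] n by (intro mult_left_mono) auto
    with 1 wval_nsets_rec[OF a(1), of k u]
    have "n * (n ^ Suc k / fact (Suc k)) - (K + C) * n ^ Suc k \<le> real (k + 2) * wval u ([V]\<^bsup>Suc (Suc k)\<^esup>)"
      unfolding a(3) by (simp add: algebra_simps)
    then have "(n * (n ^ Suc k / fact (Suc k)) - (K + C) * n ^ Suc k) / real (k + 2) \<le> wval u ([V]\<^bsup>Suc (Suc k)\<^esup>)"
      by (simp add: divide_le_eq mult.commute)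
    moreover have "(n * (n ^ Suc k / fact (Suc k)) - (K + C) * n ^ Suc k) / real (k + 2)
        = n ^ Suc (Suc k) / fact (Suc (Suc k)) - (K + C) * n ^ Suc k / real (k + 2)"
      by (simp add: diff_divide_distrib mult.commute)
    moreover have "(K + C) * n ^ Suc k / real (k + 2) \<le> (K + C) * n ^ Suc k"
    proof -
      have "0 \<le> (K + C) * n ^ Suc k" using K assms n by simp
      then show ?thesis using divide_left_mono[of 1 "real (k + 2)" "(K + C) * n ^ Suc k"] by simp
    qed
    ultimately show "n ^ Suc (Suc k) / fact (Suc (Suc k)) - (K + C) * n ^ Suc k \<le> wval u ([V]\<^bsup>Suc (Suc k)\<^esup>)"
      by linarith
  qed (use K assms in simp)
qed

text \<open>Second-order expansion: the term \<open>binomial (k + 2) 2\<close> counts the pairs of positions at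
  which a sequence of \<open>k + 2\<close> vertices can repeat a vertex.\<close>
lemma wval_nsets_upper:
  assumes "0 \<le> C"
  shows "\<exists>K\<ge>0. \<forall>V u n. finite V \<and> (\<forall>i\<in>V. 0 \<le> u i \<and> u i \<le> C) \<and> sum u V = n \<longrightarrow>
    wval u ([V]\<^bsup>(k + 2)\<^esup>) \<le> (n ^ (k + 2) - real ((k + 2) choose 2) * (\<Sum>i\<in>V. (u i)\<^sup>2) * n ^ k) / fact (k + 2)
      + K * n ^ k"
proof (induction k)
  case 0
  show ?case
  proof (rule exI[of _ 0], intro conjI allI impI)
    fix V and u :: "nat \<Rightarrow> real" and n
    assume "finite V \<and> (\<forall>i\<in>V. 0 \<le> u i \<and> u i \<le> C) \<and> sum u V = n"
    then have "finite V" "sum u V = n" by auto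
    then have e: "wval u ([V]\<^bsup>2\<^esup>) = (n\<^sup>2 - (\<Sum>i\<in>V. (u i)\<^sup>2)) / 2"
      using wval_nsets_2[of V u] by simp
    show "wval u ([V]\<^bsup>(0 + 2)\<^esup>) \<le> (n ^ (0 + 2) - real ((0 + 2) choose 2) * (\<Sum>i\<in>V. (u i)\<^sup>2) * n ^ 0) / fact (0 + 2)
      + 0 * n ^ 0"
      unfolding add_0 fact_2 binomial_n_n power_0 e by simp
  qed (rule order_refl)
next
  case (Suc k)
  obtain K where K': "0 \<le> K \<and> (\<forall>V u n. finite V \<and> (\<forall>i\<in>V. 0 \<le> u i \<and> u i \<le> C) \<and> sum u V = n \<longrightarrow>
      wval u ([V]\<^bsup>(k + 2)\<^esup>)
        \<le> (n ^ (k + 2) - real ((k + 2) choose 2) * (\<Sum>i\<in>V. (u i)\<^sup>2) * n ^ k) / fact (k + 2) + K * n ^ k)"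
    using Suc.IH by (rule exE)
  obtain K1 where K1': "0 \<le> K1 \<and> (\<forall>V u n. finite V \<and> (\<forall>i\<in>V. 0 \<le> u i \<and> u i \<le> C) \<and> sum u V = n \<longrightarrow>
      n ^ Suc k / fact (Suc k) - K1 * n ^ k \<le> wval u ([V]\<^bsup>Suc k\<^esup>))"
    using wval_nsets_lower[OF assms, of k] by (rule exE)
  note K = conjunct1[OF K'] and IH = conjunct2[OF K', rule_format]
    and K1 = conjunct1[OF K1'] and low = conjunct2[OF K1', rule_format]
  show ?case
  proof (rule exI[of _ "K + C * (K1 + C)"], intro conjI allI impI)
    fix V and u :: "nat \<Rightarrow> real" and n
    assume h: "finite V \<and> (\<forall>i\<in>V. 0 \<le> u i \<and> u i \<le> C) \<and> sum u V = n"
    then have a: "finite V" "\<forall>i\<in>V. 0 \<le> u i \<and> u i \<le> C" "sum u V = n" by auto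
    define s where "s = (\<Sum>i\<in>V. (u i)\<^sup>2)"
    have n: "0 \<le> n" using a by (metis sum_nonneg)
    have "s \<le> (\<Sum>i\<in>V. C * u i)"
      unfolding s_def using a by (intro sum_mono) (auto simp: power2_eq_square intro!: mult_mono)
    then have s: "s \<le> C * n" using a by (simp flip: sum_distrib_left)
    \<comment> \<open>The recursion subtracts the terms with \<open>V - {i}\<close>, so the upper
      bound for e_(k+3) needs a lower bound for them.\<close>
    have ek: "n ^ Suc k / fact (Suc k) - (K1 + C) * n ^ k \<le> wval u ([V - {i}]\<^bsup>Suc k\<^esup>)" if i: "i \<in> V" for i
    proof -
      have "wval u ([V - {i}]\<^bsup>k\<^esup>) \<le> wval u ([V]\<^bsup>k\<^esup>)"
        using a by (intro wval_mono finite_imp_finite_nsets nsets_mono) (auto simp: nsets_def)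
      also have "\<dots> \<le> fact k * wval u ([V]\<^bsup>k\<^esup>)"
        using a wval_nsets_nonneg[of V u k] fact_ge_1[of k] mult_right_mono[of 1 "fact k :: real"] by fastforce
      also have "\<dots> \<le> n ^ k" using wval_nsets_le_power[of V u k] a by auto
      finally have "u i * wval u ([V - {i}]\<^bsup>k\<^esup>) \<le> C * n ^ k"
        using a i assms by (intro mult_mono) (auto intro!: wval_nsets_nonneg)
      with wval_nsets_peel[OF a(1) i, of u k] low[OF h] show ?thesis by (simp add: algebra_simps)
    qed
    have "s * (n ^ Suc k / fact (Suc k) - (K1 + C) * n ^ k)
        \<le> (\<Sum>i\<in>V. (u i)\<^sup>2 * wval u ([V - {i}]\<^bsup>Suc k\<^esup>))"
      unfolding s_def sum_distrib_right using ek by (intro sum_mono mult_left_mono) auto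
    moreover have "s * ((K1 + C) * n ^ k) \<le> C * n * ((K1 + C) * n ^ k)"
      using s K1 assms n by (intro mult_right_mono) auto
    ultimately have 1: "s * n ^ Suc k / fact (Suc k) - C * (K1 + C) * n ^ Suc k
        \<le> (\<Sum>i\<in>V. (u i)\<^sup>2 * wval u ([V - {i}]\<^bsup>Suc k\<^esup>))"
      by (simp add: algebra_simps)
    have 2: "n * wval u ([V]\<^bsup>(k + 2)\<^esup>) \<le> n * ((n ^ (k + 2) - real ((k + 2) choose 2) * s * n ^ k) / fact (k + 2) + K * n ^ k)"
      using IH[OF h] n unfolding s_def by (intro mult_left_mono) auto
    have "real (k + 3) * wval u ([V]\<^bsup>(Suc k + 2)\<^esup>)
        = n * wval u ([V]\<^bsup>(k + 2)\<^esup>) - (\<Sum>i\<in>V. (u i)\<^sup>2 * wval u ([V - {i}]\<^bsup>Suc k\<^esup>))"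
      using wval_nsets_rec[OF a(1), of "Suc k" u] a(3) by (simp add: add.commute)
    also have "\<dots> \<le> n * ((n ^ (k + 2) - real ((k + 2) choose 2) * s * n ^ k) / fact (k + 2) + K * n ^ k)
        - (s * n ^ Suc k / fact (Suc k) - C * (K1 + C) * n ^ Suc k)"
      using 1 2 by linarith
    also have "s * n ^ Suc k / fact (Suc k) = real (k + 2) * s * n ^ Suc k / fact (k + 2)"
      by (simp add: divide_simps)
    also have "n * ((n ^ (k + 2) - real ((k + 2) choose 2) * s * n ^ k) / fact (k + 2) + K * n ^ k)
        - (real (k + 2) * s * n ^ Suc k / fact (k + 2) - C * (K1 + C) * n ^ Suc k)
      = (n ^ (k + 3) - (real ((k + 2) choose 2) + real (k + 2)) * s * n ^ Suc k) / fact (k + 2)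
        + (K + C * (K1 + C)) * n ^ Suc k"
    proof -
      have gen: "n * ((a - c * s * p) / F + K * p) - (m * s * (n * p) / F - Q * (n * p))
          = (n * a - (c + m) * s * (n * p)) / F + (K + Q) * (n * p)" for a c p F m Q :: real
        by (simp add: diff_divide_distrib add_divide_distrib algebra_simps)
      have e3: "n ^ (k + 3) = n * n ^ (k + 2)" by (simp add: eval_nat_numeral)
      show ?thesis unfolding power_Suc e3 by (rule gen)
    qed
    \<comment> \<open>Pascal's rule: the old pairs of positions and the \<open>k + 2\<close> pairs
      with the new one.\<close>
    also have "real ((k + 2) choose 2) + real (k + 2) = real ((Suc k + 2) choose 2)"
      by (simp add: numeral_2_eq_2)
    finally have "real (k + 3) * wval u ([V]\<^bsup>(Suc k + 2)\<^esup>)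
      \<le> (n ^ (k + 3) - real ((Suc k + 2) choose 2) * s * n ^ Suc k) / fact (k + 2) + (K + C * (K1 + C)) * n ^ Suc k" .
    then have "wval u ([V]\<^bsup>(Suc k + 2)\<^esup>) \<le> ((n ^ (k + 3) - real ((Suc k + 2) choose 2) * s * n ^ Suc k) / fact (k + 2)
       + (K + C * (K1 + C)) * n ^ Suc k) / real (k + 3)"
      by (simp add: le_divide_eq mult.commute)
    also have "\<dots> = (n ^ (k + 3) - real ((Suc k + 2) choose 2) * s * n ^ Suc k) / fact (k + 3)
       + (K + C * (K1 + C)) * n ^ Suc k / real (k + 3)"
      by (simp add: add_divide_distrib numeral_3_eq_3 mult.commute)
    also have "\<dots> \<le> (n ^ (k + 3) - real ((Suc k + 2) choose 2) * s * n ^ Suc k) / fact (k + 3)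
       + (K + C * (K1 + C)) * n ^ Suc k"
    proof -
      have "0 \<le> (K + C * (K1 + C)) * n ^ Suc k" using K K1 assms n by simp
      then show ?thesis using divide_left_mono[of 1 "real (k + 3)" "(K + C * (K1 + C)) * n ^ Suc k"] by simp
    qed
    finally show "wval u ([V]\<^bsup>(Suc k + 2)\<^esup>) \<le> (n ^ (Suc k + 2) - real ((Suc k + 2) choose 2) *
       (\<Sum>i\<in>V. (u i)\<^sup>2) * n ^ Suc k) / fact (Suc k + 2) + (K + C * (K1 + C)) * n ^ Suc k"
      unfolding s_def by (simp add: eval_nat_numeral)
  qed (use K K1 assms in simp)
qed

section \<open>Moments of a stationary weighting\<close>

lemma binomial_le_power: "n choose s \<le> n ^ s"
proof -
  have "(n choose s) * 1 \<le> (n choose s) * fact s" by (intro mult_left_mono) auto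
  also have "\<dots> \<le> n ^ s" by (rule binomial_fact_pow)
  finally show ?thesis by simp
qed

lemma card_mult_power_le_wval:
  assumes "\<And>f. f \<in> F \<Longrightarrow> card f = k" "\<And>f i. f \<in> F \<Longrightarrow> i \<in> f \<Longrightarrow> b \<le> u i" "0 \<le> b"
  shows "real (card F) * b ^ k \<le> wval u F"
proof -
  have "b ^ k \<le> (\<Prod>i\<in>f. u i)" if "f \<in> F" for f
    using prod_mono[of f "\<lambda>_. b" u] assms that by simp
  then have "(\<Sum>f\<in>F. b ^ k) \<le> wval u F" unfolding wval_def by (intro sum_mono) auto
  then show ?thesis by simp
qed

text \<open>Weights are scaled to total mass \<open>n\<close>, so that the uniform weighting of \<open>n\<close> vertices is
  constantly 1. The equation for the links is the Lagrange multiplier condition.\<close>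
definition stationary :: "nat \<Rightarrow> nat \<Rightarrow> nat set \<Rightarrow> nat set set \<Rightarrow> (nat \<Rightarrow> real) \<Rightarrow> bool" where
  "stationary r n V G u \<longleftrightarrow> finite V \<and> G \<subseteq> [V]\<^bsup>r\<^esup> \<and> (\<forall>i\<in>V. 0 < u i) \<and> sum u V = real n \<and>
     (\<forall>x\<in>V. real n * wval u (link x G) = real r * wval u G) \<and> real (n choose r) \<le> wval u G"

lemma stationary_edges_lower:
  assumes "stationary (k + 2) n V G u"
  shows "real n * (real n ^ Suc k - real ((k + 2) choose 2) * real n ^ k) \<le> fact (k + 2) * wval u G"
proof -
  have "real n * (real n ^ Suc k - real ((k + 2) choose 2) * real n ^ k)
      \<le> fact (k + 2) * real (n choose (k + 2))"
    using binomial_lower_bound[of n "Suc k"] by (simp add: algebra_simps)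
  also have "\<dots> \<le> fact (k + 2) * wval u G"
    using assms by (intro mult_left_mono) (auto simp: stationary_def)
  finally show ?thesis .
qed

text \<open>The right-hand side is at most \<open>n ^ Suc k\<close> for any graph on mass
  \<open>n\<close>. The multiplier condition brings every vertex, however light, within a constant
  times \<open>n ^ k\<close> of that.\<close>

lemma stationary_link_lower:
  assumes "stationary (k + 2) n V G u" "0 < n" "x \<in> V"
  shows "real n ^ Suc k - real ((k + 2) choose 2) * real n ^ k \<le> fact (Suc k) * wval u (link x G)"
proof -
  have "real n * wval u (link x G) = real (k + 2) * wval u G"
    using assms by (auto simp: stationary_def)
  then have "fact (Suc k) * (real n * wval u (link x G)) = fact (k + 2) * wval u G"
    by (simp add: algebra_simps)
  then have "real n * (real n ^ Suc k - real ((k + 2) choose 2) * real n ^ k)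
      \<le> real n * (fact (Suc k) * wval u (link x G))"
    using stationary_edges_lower[OF assms(1)] by (simp only: mult.left_commute)
  then show ?thesis using assms(2) by (simp only: mult_le_cancel_left_pos of_nat_0_less_iff)
qed

text \<open>The link of \<open>x\<close> lives on the remaining mass \<open>n - u x\<close>, so a
  large \<open>u x\<close> would make it lighter than \<open>stationary_link_lower\<close>
  allows.\<close>

lemma stationary_weight_le:
  assumes st: "stationary (k + 2) n V G u" and n: "0 < n" and x: "x \<in> V"
  shows "u x \<le> real ((k + 2) choose 2)"
proof -
  let ?c = "real ((k + 2) choose 2)"
  have V: "finite V" "\<forall>i\<in>V. 0 < u i" "sum u V = real n" "G \<subseteq> [V]\<^bsup>Suc (Suc k)\<^esup>"
    using st by (auto simp: stationary_def)
  have s: "sum u (V - {x}) = real n - u x"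
    using V x by (simp add: sum_diff1)
  then have d: "0 \<le> real n - u x" using V by (metis DiffD1 less_imp_le sum_nonneg)
  have "link x G \<subseteq> [V - {x}]\<^bsup>Suc k\<^esup>"
    using V(4) link_nsets[OF x, of "Suc k"] by (auto simp: link_def)
  then have "wval u (link x G) \<le> wval u ([V - {x}]\<^bsup>Suc k\<^esup>)"
    using V by (intro wval_mono finite_imp_finite_nsets) (auto simp: nsets_def intro: less_imp_le)
  then have "fact (Suc k) * wval u (link x G) \<le> fact (Suc k) * wval u ([V - {x}]\<^bsup>Suc k\<^esup>)"
    by (intro mult_left_mono) auto
  also have "\<dots> \<le> (real n - u x) ^ Suc k"
    using wval_nsets_le_power[of "V - {x}" u "Suc k"] V s by (auto intro: less_imp_le)
  also have "\<dots> \<le> (real n - u x) * real n ^ k"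
  proof -
    have "0 < u x" using V x by auto
    then have "(real n - u x) ^ k \<le> real n ^ k" using d by (intro power_mono) auto
    then show ?thesis using d by (simp add: mult_left_mono)
  qed
  finally have "real n ^ Suc k - ?c * real n ^ k \<le> (real n - u x) * real n ^ k"
    using stationary_link_lower[OF st n x] by linarith
  then have "real n ^ k * u x \<le> real n ^ k * ?c" by (simp add: algebra_simps)
  then show ?thesis using n by (simp add: mult_le_cancel_left_pos)
qed

text \<open>For an edge of weight \<open>s\<close> we have \<open>s * (1 - ln s) \<le> 1\<close>. Summed over the edges, the link
  equation turns the left-hand side into an entropy of \<open>u\<close>; its quadratic correction
  \<open>ln t \<le> (t - 1) - (t - 1)\<^sup>2 / D\<close> controls the variance.\<close>
lemma stationary_moments:
  assumes st: "stationary (k + 2) n V G u" and n: "k + 2 \<le> n"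
    and card: "card G \<le> (n choose (k + 2)) + ((n - 1) choose (k + 1))"
  shows "(\<Sum>i\<in>V. u i * (u i - 1)\<^sup>2)
    \<le> (sqrt (real ((k + 2) choose 2)) + 1)\<^sup>2 * ((\<Sum>i\<in>V. (u i)\<^sup>2) - real n + 1)"
proof -
  define c where "c = real ((k + 2) choose 2)"
  define D where "D = (sqrt c + 1)\<^sup>2"
  define g where "g i = (u i - 1) - (u i - 1)\<^sup>2 / D" for i
  define Z where "Z = (\<Sum>i\<in>V. u i * g i)"
  let ?L = "wval u G" and ?B = "real (n choose (k + 2))"
  have c: "0 \<le> c" by (simp add: c_def)
  then have "0 < sqrt c + 1" by (simp add: add_nonneg_pos)
  then have D: "0 < D" unfolding D_def by (rule zero_less_power)
  have V: "finite V" "\<forall>i\<in>V. 0 < u i" "sum u V = real n" "G \<subseteq> [V]\<^bsup>(k + 2)\<^esup>" "?B \<le> ?L"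
    and lnk: "\<And>i. i \<in> V \<Longrightarrow> real n * wval u (link i G) = real (k + 2) * ?L"
    using st by (auto simp: stationary_def)
  have sub: "f \<subseteq> V" if "f \<in> G" for f using V that by (auto simp: nsets_def)
  have np: "0 < real n" using n by simp
  have "(\<Sum>f\<in>G. (\<Prod>i\<in>f. u i) * (1 - (\<Sum>i\<in>f. g i))) \<le> (\<Sum>f\<in>G. 1)"
  proof (intro sum_mono prod_log_bound)
    fix f i assume "f \<in> G" "i \<in> f"
    then have i: "i \<in> V" using sub by blast
    then show "0 < u i" using V by auto
    then show "ln (u i) \<le> g i"
      unfolding g_def D_def using stationary_weight_le[OF st _ i] n by (intro ln_le_quadratic) (auto simp: c_def)
  qed
  also have "(\<Sum>f\<in>G. (\<Prod>i\<in>f. u i) * (1 - (\<Sum>i\<in>f. g i))) = ?L - (\<Sum>f\<in>G. (\<Sum>i\<in>f. g i) * (\<Prod>i\<in>f. u i))"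
    by (simp add: wval_def right_diff_distrib sum_subtractf mult.commute)
  also have "(\<Sum>f\<in>G. (\<Sum>i\<in>f. g i) * (\<Prod>i\<in>f. u i)) = (\<Sum>i\<in>V. g i * (u i * wval u (link i G)))"
    using V sub by (intro sum_link)
  also have "\<dots> = (\<Sum>i\<in>V. (u i * g i) * (real (k + 2) * ?L / real n))"
  proof (intro sum.cong refl)
    fix i assume "i \<in> V"
    from lnk[OF this] have "wval u (link i G) = real (k + 2) * ?L / real n"
      using np by (metis nonzero_mult_div_cancel_left less_irrefl)
    then show "g i * (u i * wval u (link i G)) = (u i * g i) * (real (k + 2) * ?L / real n)"
      by simp
  qed
  also have "\<dots> = Z * (real (k + 2) * ?L / real n)"
    by (simp only: Z_def sum_distrib_right)
  finally have "?L - Z * (real (k + 2) * ?L / real n) \<le> real (card G)" by simp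
  then have edges: "?L * (real n - real (k + 2) * Z) \<le> real n * real (card G)"
    using np by (simp add: field_simps)
  have "n * ((n - 1) choose (k + 1)) = (k + 2) * (n choose (k + 2))"
    using binomial_absorption[of "k + 1" n] by simp
  then have "real n * real ((n - 1) choose (k + 1)) = real (k + 2) * ?B"
    by (metis of_nat_mult)
  moreover have "real (card G) \<le> ?B + real ((n - 1) choose (k + 1))"
    using card by (simp flip: of_nat_add)
  then have "real n * real (card G) \<le> real n * (?B + real ((n - 1) choose (k + 1)))"
    by (intro mult_left_mono) auto
  ultimately have edges': "real n * real (card G) \<le> ?B * (real n + real (k + 2))"
    by (simp add: algebra_simps)
  \<comment> \<open>\<open>edges\<close> bounds \<open>?L * (1 - (k + 2) * Z / n)\<close> by the
    number of edges, which is at most \<open>?B * (1 + (k + 2) / n)\<close>. As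
    \<open>?B \<le> ?L\<close>, comparing the brackets gives exactly -1.\<close>
  have "-1 \<le> Z"
  proof (rule ccontr)
    assume "\<not> ?thesis"
    then have "real (k + 2) * Z < real (k + 2) * (-1)"
      by (intro mult_strict_left_mono) auto
    then have 1: "real n + real (k + 2) < real n - real (k + 2) * Z" by simp
    have "0 < ?B" using n by simp
    then have "?B * (real n + real (k + 2)) < ?B * (real n - real (k + 2) * Z)"
      using 1 by (intro mult_strict_left_mono)
    also have "\<dots> \<le> ?L * (real n - real (k + 2) * Z)"
      using 1 np V(5) by (intro mult_right_mono) linarith+
    finally show False using edges edges' by linarith
  qed
  moreover have "Z = (\<Sum>i\<in>V. (u i)\<^sup>2) - real n - (\<Sum>i\<in>V. u i * (u i - 1)\<^sup>2) / D"
  proof -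
    have "Z = (\<Sum>i\<in>V. (u i)\<^sup>2 - u i - u i * (u i - 1)\<^sup>2 / D)"
      by (simp add: Z_def g_def algebra_simps power2_eq_square)
    then show ?thesis using V by (simp add: sum_subtractf sum_divide_distrib)
  qed
  ultimately have "(\<Sum>i\<in>V. u i * (u i - 1)\<^sup>2) / D \<le> (\<Sum>i\<in>V. (u i)\<^sup>2) - real n + 1" by linarith
  then show ?thesis using D by (simp add: D_def c_def divide_le_eq mult.commute)
qed

text \<open>Let \<open>s\<close> be the sum of squares. The expansion of the weight of all sets
  minus the lower bound for \<open>G\<close> dominates the weight of the non-edges. This weight is
  nonnegative, which bounds \<open>s - n\<close> above and with it the entropy bound. Conversely the
  entropy bound forces \<open>s \<ge> n - 1\<close>, which makes the same difference at most a
  multiple of \<open>n ^ k\<close>.\<close>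

lemma stationary_nonedges:
  "\<exists>K\<ge>0. \<forall>n V G u. stationary (k + 2) n V G u \<and> k + 2 \<le> n \<and>
     card G \<le> (n choose (k + 2)) + ((n - 1) choose (k + 1)) \<longrightarrow>
     (\<Sum>i\<in>V. (u i)\<^sup>2) \<le> real n + K \<and> (\<Sum>i\<in>V. u i * (u i - 1)\<^sup>2) \<le> K \<and>
     wval u ([V]\<^bsup>(k + 2)\<^esup> - G) \<le> K * real n ^ k"
proof -
  define c where "c = real ((k + 2) choose 2)"
  have "1 \<le> (k + 2) choose 2" using zero_less_binomial[of 2 "k + 2"] by linarith
  then have c: "1 \<le> c" unfolding c_def by (metis of_nat_1 of_nat_le_iff)
  have c0: "0 \<le> c" using c by simp
  obtain K0 where K0': "0 \<le> K0 \<and> (\<forall>V u n. finite V \<and> (\<forall>i\<in>V. 0 \<le> u i \<and> u i \<le> c) \<and> sum u V = n \<longrightarrow>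
      wval u ([V]\<^bsup>(k + 2)\<^esup>)
        \<le> (n ^ (k + 2) - real ((k + 2) choose 2) * (\<Sum>i\<in>V. (u i)\<^sup>2) * n ^ k) / fact (k + 2) + K0 * n ^ k)"
    using wval_nsets_upper[OF c0, of k] by (rule exE)
  note K0 = conjunct1[OF K0'] and up = conjunct2[OF K0', rule_format]
  define D where "D = (sqrt c + 1)\<^sup>2"
  define F where "F = (fact (k + 2) :: real)"
  have F: "1 \<le> F" unfolding F_def by (rule fact_ge_1)
  have D: "1 \<le> D" unfolding D_def using c by simp
  define K where "K = D * (F * K0 + 1) + c + K0"
  have FK: "0 \<le> F * K0" using F K0 by simp
  have "F * K0 + 1 \<le> D * (F * K0 + 1)" using FK D mult_right_mono[of 1 D "F * K0 + 1"] by simp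
  then have K: "F * K0 \<le> K" "D * (F * K0 + 1) \<le> K" "c + K0 \<le> K"
    unfolding K_def using c K0 FK by linarith+
  show ?thesis
  proof (rule exI[of _ K], rule conjI, use K FK in linarith, intro allI impI)
    fix n V G u
    assume "stationary (k + 2) n V G u \<and> k + 2 \<le> n \<and>
     card G \<le> (n choose (k + 2)) + ((n - 1) choose (k + 1))"
    then have a: "stationary (k + 2) n V G u" "k + 2 \<le> n"
      "card G \<le> (n choose (k + 2)) + ((n - 1) choose (k + 1))" by auto
    have V: "finite V" "\<forall>i\<in>V. 0 < u i" "sum u V = real n" "G \<subseteq> [V]\<^bsup>(k + 2)\<^esup>"
      using a by (auto simp: stationary_def)
    define s where "s = (\<Sum>i\<in>V. (u i)\<^sup>2)"
    define T where "T = (\<Sum>i\<in>V. u i * (u i - 1)\<^sup>2)"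
    define P where "P = real n ^ k"
    have P: "0 < P" using a by (simp add: P_def)
    have T0: "0 \<le> T" unfolding T_def using V by (intro sum_nonneg) (auto intro: less_imp_le)
    have T: "T \<le> D * (s - real n + 1)"
      using stationary_moments[OF a] by (simp add: T_def s_def D_def c_def)
    have s1: "0 \<le> s - real n + 1"
      using T T0 D by (smt (verit) zero_le_mult_iff)
    have pw: "real n ^ (k + 2) = real n * (real n * P)" by (simp add: P_def)
    have "finite V \<and> (\<forall>i\<in>V. 0 \<le> u i \<and> u i \<le> c) \<and> sum u V = real n"
      using V stationary_weight_le[OF a(1)] a(2) unfolding c_def by (auto intro: less_imp_le)
    from up[OF this] have U: "wval u ([V]\<^bsup>(k + 2)\<^esup>) \<le> (real n * (real n * P) - c * s * P) / F + K0 * P"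
      unfolding s_def[symmetric] c_def[symmetric] F_def[symmetric] pw P_def[symmetric] .
    have "real n * (real n * P - c * P) \<le> F * wval u G"
      using stationary_edges_lower[OF a(1)] by (simp add: F_def P_def c_def)
    then have Lo: "(real n * (real n * P) - c * real n * P) / F \<le> wval u G"
      using F by (simp add: divide_le_eq algebra_simps)
    have N: "wval u ([V]\<^bsup>(k + 2)\<^esup>) = wval u G + wval u ([V]\<^bsup>(k + 2)\<^esup> - G)"
      using V by (intro wval_split finite_imp_finite_nsets)
    have N0: "0 \<le> wval u ([V]\<^bsup>(k + 2)\<^esup> - G)"
      using V by (intro wval_nonneg) (auto simp: nsets_def intro: less_imp_le)
    have "wval u ([V]\<^bsup>(k + 2)\<^esup> - G) \<le> (real n * (real n * P) - c * s * P) / F - (real n * (real n * P) - c * real n * P) / F + K0 * P"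
      using U Lo N by linarith
    also have "\<dots> = c * (real n - s) * P / F + K0 * P"
      by (simp add: diff_divide_distrib algebra_simps)
    finally have NN: "wval u ([V]\<^bsup>(k + 2)\<^esup> - G) \<le> c * (real n - s) * P / F + K0 * P" .
    with N0 have "0 \<le> (c * (real n - s) / F + K0) * P" by (simp add: algebra_simps)
    then have "0 \<le> c * (real n - s) / F + K0" using P by (simp add: zero_le_mult_iff)
    then have s2: "c * (s - real n) \<le> F * K0" using F by (simp add: field_simps)
    have s3: "s - real n \<le> F * K0"
    proof (cases "0 \<le> s - real n")
      case True
      then have "s - real n \<le> c * (s - real n)" using c mult_right_mono[of 1 c "s - real n"] by simp
      with s2 show ?thesis by linarith
    qed (use FK in linarith)
    have "s \<le> real n + K" using s3 K by linarith
    moreover have "T \<le> K"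
    proof -
      have "D * (s - real n + 1) \<le> D * (F * K0 + 1)" using s3 D by (intro mult_left_mono) auto
      with T K show ?thesis by linarith
    qed
    moreover have "wval u ([V]\<^bsup>(k + 2)\<^esup> - G) \<le> K * P"
    proof -
      have "c * (real n - s) / F \<le> c * 1 / 1"
        using s1 c F FK by (intro frac_le mult_left_mono) (auto simp: mult_le_cancel_left1)
      then have "(c * (real n - s) / F + K0) * P \<le> K * P"
        using K P by (intro mult_right_mono) linarith+
      with NN show ?thesis by (simp add: algebra_simps)
    qed
    ultimately show "(\<Sum>i\<in>V. (u i)\<^sup>2) \<le> real n + K \<and> (\<Sum>i\<in>V. u i * (u i - 1)\<^sup>2) \<le> K \<and>
     wval u ([V]\<^bsup>(k + 2)\<^esup> - G) \<le> K * real n ^ k" unfolding s_def T_def P_def by blast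
  qed
qed

section \<open>The number of vertices\<close>

text \<open>On \<open>n + 2\<close> vertices so few edges miss sets in number of order
  \<open>n ^ (k + 1)\<close>, but only order \<open>n ^ k\<close> can be missing. The non-edge bound
  handles sets of heavy vertices; for one light vertex its link is used, whose weight does not
  depend on how light the vertex is.\<close>

lemma stationary_card:
  "\<exists>n0. \<forall>n\<ge>n0. \<forall>V G u. stationary (k + 2) n V G u \<and>
     card G \<le> (n choose (k + 2)) + ((n - 1) choose (k + 1)) \<longrightarrow> card V \<le> n + 1"
proof -
  define c where "c = real ((k + 2) choose 2)"
  obtain K where K': "0 \<le> K \<and> (\<forall>n V G u. stationary (k + 2) n V G u \<and> k + 2 \<le> n \<and>
     card G \<le> (n choose (k + 2)) + ((n - 1) choose (k + 1)) \<longrightarrow>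
     (\<Sum>i\<in>V. (u i)\<^sup>2) \<le> real n + K \<and> (\<Sum>i\<in>V. u i * (u i - 1)\<^sup>2) \<le> K \<and>
     wval u ([V]\<^bsup>(k + 2)\<^esup> - G) \<le> K * real n ^ k)"
    using stationary_nonedges[of k] by (rule exE)
  note K = conjunct1[OF K'] and bounds = conjunct2[OF K', rule_format]
  \<comment> \<open>In units of \<open>n ^ k\<close>: missing sets with no vertex, then with one
    vertex, of weight below 1/2; last, all sets with two or more.\<close>
  define Q where "Q = 2 ^ (k + 2) * K + (9 * K + 2) * 2 ^ Suc k * c + (9 * K + 2)\<^sup>2 * 3 ^ k"
  define B where "B = real (Suc k choose 2) + fact (Suc k) * Q"
  obtain n0 :: nat where n0: "B < real n0" using reals_Archimedean2 by blast
  have "card V \<le> n + 1" if n: "max n0 (k + 2) \<le> n" and st: "stationary (k + 2) n V G u"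
    and card: "card G \<le> (n choose (k + 2)) + ((n - 1) choose (k + 1))" for n V G u
  proof (rule ccontr)
    assume "\<not> card V \<le> n + 1"
    then have big: "n + 2 \<le> card V" by simp
    have n1: "n0 \<le> n" "k + 2 \<le> n" "0 < n" using n by auto
    have V: "finite V" "\<forall>i\<in>V. 0 < u i" "sum u V = real n" "G \<subseteq> [V]\<^bsup>(k + 2)\<^esup>"
      using st by (auto simp: stationary_def)
    have bd: "(\<Sum>i\<in>V. (u i)\<^sup>2) \<le> real n + K" "(\<Sum>i\<in>V. u i * (u i - 1)\<^sup>2) \<le> K"
      "wval u ([V]\<^bsup>(k + 2)\<^esup> - G) \<le> K * real n ^ k"
      using bounds[of n V G u] st card n1 by auto
    define X where "X = {i\<in>V. 1 / 2 \<le> u i}"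
    have X: "X \<subseteq> V" "finite X" using V by (auto simp: X_def)
    \<comment> \<open>Light vertices have \<open>(u i - 1)^2 \<ge> 1/4\<close>, so they carry at
      most \<open>4 * K\<close>. On \<open>X\<close>, \<open>2 * u i - (u i)^2 \<le> 1\<close> turns
      mass into a count: \<open>2 * (n - 4 * K) - (n + K) = n - 9 * K\<close>.\<close>
    have cardX: "real n - 9 * K \<le> real (card X)"
    proof -
      have "(\<Sum>i\<in>V - X. u i * (1 / 4)) \<le> (\<Sum>i\<in>V - X. u i * (u i - 1)\<^sup>2)"
      proof (intro sum_mono mult_left_mono)
        fix i assume i: "i \<in> V - X"
        then have "(1 / 2)\<^sup>2 \<le> (1 - u i)\<^sup>2" by (intro power_mono) (auto simp: X_def)
        then show "1 / 4 \<le> (u i - 1)\<^sup>2" by (simp add: power2_eq_square algebra_simps)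
      qed (use V in \<open>auto intro: less_imp_le\<close>)
      also have "\<dots> \<le> (\<Sum>i\<in>V. u i * (u i - 1)\<^sup>2)"
        using V by (intro sum_mono2) (auto intro: less_imp_le)
      finally have "sum u (V - X) \<le> 4 * K" using bd(2) by (simp flip: sum_divide_distrib)
      then have sX: "real n - 4 * K \<le> sum u X" using V(3) X V(1) by (simp add: sum_diff)
      have "(\<Sum>i\<in>X. 2 * u i - (u i)\<^sup>2) \<le> (\<Sum>i\<in>X. 1)"
      proof (intro sum_mono)
        fix i
        have "0 \<le> (u i - 1)\<^sup>2" by simp
        then show "2 * u i - (u i)\<^sup>2 \<le> 1" by (simp add: power2_diff)
      qed
      then have "2 * sum u X - (\<Sum>i\<in>X. (u i)\<^sup>2) \<le> real (card X)"
        by (simp add: sum_subtractf sum_distrib_left)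
      moreover have "(\<Sum>i\<in>X. (u i)\<^sup>2) \<le> (\<Sum>i\<in>V. (u i)\<^sup>2)"
        using V X by (intro sum_mono2) auto
      ultimately show ?thesis using sX bd(1) by linarith
    qed
    obtain W where W: "W \<subseteq> V" "card W = n + 2" "real (card (W - X)) \<le> 9 * K + 2"
    proof (cases "n + 2 \<le> card X")
      case True
      then obtain W where W: "W \<subseteq> X" "card W = n + 2" using obtain_subset_with_card_n[OF True] by blast
      then have e: "W - X = {}" by auto
      have "real (card (W - X)) \<le> 9 * K + 2" unfolding e using K by simp
      with W X show thesis using that by blast
    next
      case False
      then obtain W where W: "X \<subseteq> W" "W \<subseteq> V" "card W = n + 2"
        using exists_subset_between[of X "n + 2" V] X big V by auto
      then have "card (W - X) = n + 2 - card X" using X by (simp add: card_Diff_subset)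
      then have "real (card (W - X)) \<le> 9 * K + 2" using False cardX by (simp add: of_nat_diff)
      with W show thesis using that by blast
    qed
    define Y where "Y = W - X"
    have fin: "finite W" "finite Y" using W V by (auto simp: Y_def intro: finite_subset)
    define A1 where "A1 = ([V]\<^bsup>(k + 2)\<^esup> - G) \<inter> [X]\<^bsup>(k + 2)\<^esup>"
    define M where "M y = [X]\<^bsup>Suc k\<^esup> - link y G" for y
    define A3 where "A3 = {f \<in> [W]\<^bsup>(k + 2)\<^esup>. 2 \<le> card (f \<inter> Y)}"
    have finM: "finite (M y)" for y using X by (simp add: M_def finite_imp_finite_nsets)
    have finA: "finite A1" "finite A3" "finite G"
      using V fin by (auto simp: A1_def A3_def finite_imp_finite_nsets intro: finite_subset)
    have cover: "[W]\<^bsup>(k + 2)\<^esup> \<subseteq> G \<union> A1 \<union> (\<Union>y\<in>Y. insert y ` M y) \<union> A3"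
    proof
      fix f assume f: "f \<in> [W]\<^bsup>(k + 2)\<^esup>"
      then have f': "f \<subseteq> W" "finite f" "card f = k + 2" by (auto simp: nsets_def)
      consider "f \<inter> Y = {}" | "card (f \<inter> Y) = 1" | "2 \<le> card (f \<inter> Y)"
        using f'(2) by (metis One_nat_def Suc_1 card_0_eq finite_Int less_2_cases not_less)
      then show "f \<in> G \<union> A1 \<union> (\<Union>y\<in>Y. insert y ` M y) \<union> A3"
      proof cases
        case 1
        then have "f \<in> [X]\<^bsup>(k + 2)\<^esup>" using f' by (auto simp: nsets_def Y_def)
        moreover have "f \<in> [V]\<^bsup>(k + 2)\<^esup>" using f' W by (auto simp: nsets_def)
        ultimately show ?thesis by (auto simp: A1_def)
      next
        case 2
        then obtain y where y: "f \<inter> Y = {y}" by (meson card_1_singletonE)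
        then have e: "f = insert y (f - {y})" "y \<in> Y" by auto
        have "y \<in> f" using y by blast
        then have "card (f - {y}) = Suc k" using f' by simp
        then have "f - {y} \<in> [X]\<^bsup>Suc k\<^esup>" using y f' by (auto simp: nsets_def Y_def)
        then have "f \<in> G \<or> f - {y} \<in> M y" using e(1) by (auto simp: M_def link_def insert_absorb)
        then show ?thesis using e by blast
      next
        case 3
        then show ?thesis using f by (simp add: A3_def)
      qed
    qed
    define P where "P = real n ^ k"
    have P: "0 < P" using n1 by (simp add: P_def)
    have cA1: "real (card A1) \<le> 2 ^ (k + 2) * K * P"
    proof -
      have "real (card A1) * (1 / 2) ^ (k + 2) \<le> wval u A1"
        by (intro card_mult_power_le_wval) (auto simp: A1_def nsets_def X_def)
      also have "\<dots> \<le> wval u ([V]\<^bsup>(k + 2)\<^esup> - G)"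
        using V by (intro wval_mono) (auto simp: A1_def nsets_def finite_imp_finite_nsets intro: less_imp_le)
      also have "\<dots> \<le> K * P" using bd(3) by (simp add: P_def)
      finally show ?thesis by (simp add: power_one_over field_simps)
    qed
    have cM: "real (card (M y)) \<le> 2 ^ Suc k * c * P" if y: "y \<in> Y" for y
    proof -
      have yV: "y \<in> V" "y \<notin> X" using y W by (auto simp: Y_def)
      let ?L = "link y G" and ?A = "[V - {y}]\<^bsup>Suc k\<^esup>"
      have LA: "?L \<subseteq> ?A" using V(4) link_nsets[OF yV(1), of "Suc k"] by (auto simp: link_def)
      have finAA: "finite ?A" using V by (simp add: finite_imp_finite_nsets)
      have "real (card (M y)) * (1 / 2) ^ Suc k \<le> wval u (M y)"
        by (intro card_mult_power_le_wval) (auto simp: M_def nsets_def X_def)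
      also have "\<dots> \<le> wval u (?A - ?L)"
      proof (intro wval_mono)
        show "M y \<subseteq> ?A - ?L" using X yV by (auto simp: M_def nsets_def)
      qed (use V finAA in \<open>auto simp: nsets_def intro: less_imp_le\<close>)
      also have "\<dots> = wval u ?A - wval u ?L"
        using wval_split[OF finAA LA, of u] by simp
      finally have 1: "real (card (M y)) * (1 / 2) ^ Suc k \<le> wval u ?A - wval u ?L" .
      have "sum u (V - {y}) \<le> real n" using V yV by (simp add: sum_diff1 less_imp_le)
      moreover have "0 \<le> sum u (V - {y})" using V by (intro sum_nonneg) (auto intro: less_imp_le)
      ultimately have "(sum u (V - {y})) ^ Suc k \<le> real n ^ Suc k" by (intro power_mono) auto
      moreover have "fact (Suc k) * wval u ?A \<le> (sum u (V - {y})) ^ Suc k"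
        using V by (intro wval_nsets_le_power) (auto intro: less_imp_le)
      ultimately have "fact (Suc k) * (wval u ?A - wval u ?L) \<le> c * P"
        using stationary_link_lower[OF st n1(3) yV(1)] unfolding right_diff_distrib c_def P_def by linarith
      moreover have "0 \<le> wval u ?A - wval u ?L" using 1 by (smt (verit) mult_nonneg_nonneg of_nat_0_le_iff zero_le_power zero_le_divide_1_iff)
      then have "wval u ?A - wval u ?L \<le> fact (Suc k) * (wval u ?A - wval u ?L)"
        using mult_right_mono[of 1 "fact (Suc k)" "wval u ?A - wval u ?L"] fact_ge_1[of "Suc k"] by simp
      ultimately have "real (card (M y)) * (1 / 2) ^ Suc k \<le> c * P" using 1 by linarith
      then show ?thesis by (simp add: power_one_over field_simps)
    qed
    have cY: "real (card Y) \<le> 9 * K + 2" using W by (simp add: Y_def)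
    have cU: "real (card (\<Union>y\<in>Y. insert y ` M y)) \<le> (9 * K + 2) * 2 ^ Suc k * c * P"
    proof -
      have "card (\<Union>y\<in>Y. insert y ` M y) \<le> (\<Sum>y\<in>Y. card (insert y ` M y))"
        using fin by (intro card_UN_le)
      also have "\<dots> \<le> (\<Sum>y\<in>Y. card (M y))" using finM by (intro sum_mono card_image_le)
      finally have "real (card (\<Union>y\<in>Y. insert y ` M y)) \<le> (\<Sum>y\<in>Y. real (card (M y)))"
        by (simp flip: of_nat_sum)
      also have "\<dots> \<le> (\<Sum>y\<in>Y. 2 ^ Suc k * c * P)" using cM by (intro sum_mono)
      also have "\<dots> \<le> (9 * K + 2) * (2 ^ Suc k * c * P)"
        using cY P by (simp only: sum_constant) (intro mult_right_mono; simp add: c_def)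
      finally show ?thesis by (simp only: mult.assoc)
    qed
    have cA3: "real (card A3) \<le> (9 * K + 2)\<^sup>2 * 3 ^ k * P"
    proof -
      have "card A3 \<le> (card Y choose 2) * (card W choose (k + 2 - 2))"
        unfolding A3_def using fin by (intro card_nsets_meeting)
      also have "\<dots> \<le> card Y ^ 2 * card W ^ k"
        using binomial_le_power[of "card Y" 2] binomial_le_power[of "card W" k] by (intro mult_le_mono) auto
      also have "\<dots> \<le> card Y ^ 2 * (3 * n) ^ k"
        using W n1 by (intro mult_le_mono power_mono) auto
      finally have "real (card A3) \<le> real (card Y ^ 2 * (3 * n) ^ k)" by (simp only: of_nat_le_iff)
      also have "\<dots> = real (card Y) ^ 2 * (3 ^ k * P)" by (simp add: power_mult_distrib P_def)
      also have "\<dots> \<le> (9 * K + 2)\<^sup>2 * (3 ^ k * P)"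
        using cY P by (intro mult_right_mono power_mono) auto
      finally show ?thesis by (simp only: mult.assoc)
    qed
    have "(n + 2) choose (k + 2) = card ([W]\<^bsup>(k + 2)\<^esup>)"
      using card_nsets_finite[OF fin(1)] W by simp
    also have "\<dots> \<le> card (G \<union> A1 \<union> (\<Union>y\<in>Y. insert y ` M y) \<union> A3)"
      using cover finA finM fin by (intro card_mono) auto
    also have "\<dots> \<le> card G + card A1 + card (\<Union>y\<in>Y. insert y ` M y) + card A3"
      by (meson card_Un_le add_le_mono order_trans order_refl)
    \<comment> \<open>By Pascal's rule this leaves at least \<open>(n + 1) choose (k + 1)\<close>
      sets to the other three families, one power of \<open>n\<close> more than they
      contain.\<close>
    also have "card G \<le> (n choose (k + 2)) + (n choose (k + 1))"
      using card binomial_right_mono[of "n - 1" n "k + 1"] by linarith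
    finally have "(n + 2) choose (k + 2) \<le> (n choose (k + 2)) + (n choose (k + 1)) +
        card A1 + card (\<Union>y\<in>Y. insert y ` M y) + card A3" by simp
    moreover have "(n + 2) choose (k + 2) = (n choose (k + 2)) + (n choose (k + 1)) + ((n + 1) choose (k + 1))"
      by simp
    ultimately have "(n choose Suc k) \<le> card A1 + card (\<Union>y\<in>Y. insert y ` M y) + card A3"
      using binomial_right_mono[of n "n + 1" "Suc k"] by simp
    then have "real (n choose Suc k) \<le> real (card A1) + real (card (\<Union>y\<in>Y. insert y ` M y)) + real (card A3)"
      by (metis of_nat_add of_nat_le_iff)
    then have "real (n choose Suc k) \<le> Q * P"
      using cA1 cU cA3 unfolding Q_def distrib_right by linarith
    then have "fact (Suc k) * real (n choose Suc k) \<le> fact (Suc k) * (Q * P)"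
      by (intro mult_left_mono) auto
    then have "real n * P \<le> B * P"
      using binomial_lower_bound[of n k] unfolding B_def P_def by (simp add: algebra_simps)
    then have "real n \<le> B" using P by simp
    with n0 n1 show False by linarith
  qed
  then show ?thesis by blast
qed

section \<open>Replacing the two lightest vertices by one\<close>

lemma prod_one_plus_le:
  fixes a :: "'a \<Rightarrow> real"
  assumes "finite A" "\<And>i. i \<in> A \<Longrightarrow> 0 \<le> a i" "\<And>i. i \<in> A \<Longrightarrow> a i \<le> C" "0 \<le> C"
  shows "(\<Prod>i\<in>A. 1 + a i) \<le> 1 + (1 + C) ^ card A * (\<Sum>i\<in>A. a i)"
  using assms(1,2,3)
proof (induction A)
  case (insert x A)
  let ?P = "\<Prod>i\<in>A. 1 + a i" and ?S = "\<Sum>i\<in>A. a i" and ?c = "(1 + C) ^ card A"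
  have "?P \<le> (\<Prod>i\<in>A. 1 + C)" using insert by (intro prod_mono) (auto simp: add_nonneg_nonneg)
  then have "a x * ?P \<le> a x * ?c" using insert by (intro mult_left_mono) auto
  moreover have "?P \<le> 1 + ?c * ?S" using insert by auto
  ultimately have "(1 + a x) * ?P \<le> 1 + ?c * (a x + ?S)" by (simp add: algebra_simps)
  also have "?c * (a x + ?S) \<le> (1 + C) ^ card (insert x A) * (a x + ?S)"
    using insert assms(4) by (intro mult_right_mono power_increasing add_nonneg_nonneg sum_nonneg) auto
  finally show ?case using insert by simp
qed simp

text \<open>Weierstrass's product inequality for factors cut off at 1, as weights above 1 only help.
  The induction also carries that the cut product is at most 1.\<close>

lemma prod_ge_one_minus_sum:
  fixes u :: "'a \<Rightarrow> real"
  assumes "finite A" "\<And>i. i \<in> A \<Longrightarrow> 0 \<le> u i"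
  shows "1 - (\<Sum>i\<in>A. max 0 (1 - u i)) \<le> (\<Prod>i\<in>A. u i)"
proof -
  have "1 - (\<Sum>i\<in>A. max 0 (1 - u i)) \<le> (\<Prod>i\<in>A. min 1 (u i)) \<and> (\<Prod>i\<in>A. min 1 (u i)) \<le> 1"
    using assms
  proof (induction A)
    case (insert x A)
    let ?P = "\<Prod>i\<in>A. min 1 (u i)" and ?p = "max 0 (1 - u x)"
    have m: "min 1 (u x) = 1 - ?p" "0 \<le> ?p" "?p \<le> 1" using insert.prems[of x] by auto
    have IH: "1 - (\<Sum>i\<in>A. max 0 (1 - u i)) \<le> ?P" "?P \<le> 1" using insert by auto
    have P: "0 \<le> ?P" using insert by (intro prod_nonneg) auto
    have "?p * ?P \<le> ?p" using mult_left_mono[OF IH(2) m(2)] by simp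
    moreover have "0 \<le> ?p * ?P" using m(2) P by (rule mult_nonneg_nonneg)
    moreover have "min 1 (u x) * ?P = ?P - ?p * ?P" unfolding m(1) by (simp add: algebra_simps)
    ultimately show ?case using IH insert.hyps by simp
  qed simp
  moreover have "(\<Prod>i\<in>A. min 1 (u i)) \<le> (\<Prod>i\<in>A. u i)" using assms by (intro prod_mono) auto
  ultimately show ?thesis by linarith
qed

text \<open>In the application \<open>a\<close> and \<open>h\<close> are the second and third largest deficits \<open>1 - u i\<close>, \<open>a + sg\<close> is the
  smallest weight and \<open>s\<^sup>2\<close> the proportion of pair edges that are present. The bracket can only be
  positive when \<open>s * (a - h) < e * E\<close>, and then the part of \<open>a + sg\<close> not bounded by \<open>2 * E\<close> is
  absorbed by the factor \<open>s\<close>.\<close>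
lemma deficit_inequality:
  fixes a h s sg e E :: real
  assumes "0 \<le> h" "h \<le> a" "h \<le> E" "\<bar>sg\<bar> \<le> E" "0 \<le> s" "s \<le> 1" "0 \<le> e" "e \<le> 1" "0 \<le> a + sg"
  shows "(a + sg) * (s\<^sup>2 * (h - a) + e * s * E) \<le> 7 * e * E\<^sup>2"
proof -
  define g where "g = a - h"
  have E: "0 \<le> E" using assms by linarith
  have g: "0 \<le> g" using assms by (simp add: g_def)
  have b: "a + sg \<le> g + 2 * E" using assms by (simp add: g_def)
  have e: "s\<^sup>2 * (h - a) + e * s * E = s * (e * E - s * g)"
    by (simp add: g_def power2_eq_square algebra_simps)
  have eE: "0 \<le> e * E" using assms E by simp
  show ?thesis
  proof (cases "s * g \<le> e * E")
    case True
    have sg0: "0 \<le> s * g" using assms g by simp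
    have "(a + sg) * (s * (e * E - s * g)) \<le> (g + 2 * E) * (s * (e * E))"
      using b assms E True sg0 by (intro mult_mono mult_left_mono) auto
    also have "\<dots> = (s * g) * (e * E) + 2 * s * (e * E\<^sup>2)" by (simp add: algebra_simps power2_eq_square)
    also have "\<dots> \<le> (e * E) * (e * E) + 2 * 1 * (e * E\<^sup>2)"
      using True assms eE by (intro add_mono mult_right_mono) auto
    also have "(e * E) * (e * E) = e * (e * E\<^sup>2)" by (simp add: power2_eq_square)
    also have "e * (e * E\<^sup>2) \<le> 1 * (e * E\<^sup>2)" using assms by (intro mult_right_mono) auto
    finally have "(a + sg) * (s * (e * E - s * g)) \<le> 3 * (e * E\<^sup>2)" by simp
    moreover have "0 \<le> e * E\<^sup>2" using assms by simp
    ultimately show ?thesis unfolding e by linarith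
  next
    case False
    then have "(a + sg) * (s * (e * E - s * g)) \<le> 0"
      using assms by (intro mult_nonneg_nonpos) auto
    also have "0 \<le> 7 * e * E\<^sup>2" using assms by simp
    finally show ?thesis unfolding e .
  qed
qed

lemma ex_min_on_finite:
  fixes u :: "'a \<Rightarrow> real"
  assumes "finite V" "V \<noteq> {}"
  obtains y where "y \<in> V" "\<And>i. i \<in> V \<Longrightarrow> u y \<le> u i"
proof -
  have "Min (u ` V) \<in> u ` V" using assms by (intro Min_in) auto
  then obtain y where "y \<in> V" "u y = Min (u ` V)" by auto
  then show thesis using that assms by (metis Min_le finite_imageI imageI)
qed

lemma wval_pair_star:
  assumes "finite V" "x \<in> V" "y \<in> V" "x \<noteq> y"
  shows "wval u {f \<in> [V]\<^bsup>(k + 2)\<^esup>. x \<in> f \<and> y \<in> f} = u x * u y * wval u ([V - {x, y}]\<^bsup>k\<^esup>)"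
proof -
  have fin: "finite f" if "f \<in> [W]\<^bsup>m\<^esup>" for f m and W :: "nat set" using that by (auto simp: nsets_def)
  have "link x {f \<in> [V]\<^bsup>(k + 2)\<^esup>. y \<in> f} = {A \<in> [V - {x}]\<^bsup>Suc k\<^esup>. y \<in> A}"
    using assms(4) link_nsets[OF assms(2), of "Suc k"] by (auto simp: link_def)
  moreover have "wval u {f \<in> {f \<in> [V]\<^bsup>(k + 2)\<^esup>. y \<in> f}. x \<in> f}
      = u x * wval u (link x {f \<in> [V]\<^bsup>(k + 2)\<^esup>. y \<in> f})"
    using assms(1) fin by (intro wval_star) (auto simp: finite_imp_finite_nsets)
  moreover have "{f \<in> [V]\<^bsup>(k + 2)\<^esup>. x \<in> f \<and> y \<in> f} = {f \<in> {f \<in> [V]\<^bsup>(k + 2)\<^esup>. y \<in> f}. x \<in> f}" by auto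
  ultimately have "wval u {f \<in> [V]\<^bsup>(k + 2)\<^esup>. x \<in> f \<and> y \<in> f} = u x * wval u {A \<in> [V - {x}]\<^bsup>Suc k\<^esup>. y \<in> A}"
    by (simp only:)
  also have "wval u {A \<in> [V - {x}]\<^bsup>Suc k\<^esup>. y \<in> A} = u y * wval u (link y ([V - {x}]\<^bsup>Suc k\<^esup>))"
    using assms fin by (intro wval_star finite_imp_finite_nsets) auto
  also have "link y ([V - {x}]\<^bsup>Suc k\<^esup>) = [V - {x, y}]\<^bsup>k\<^esup>"
    using link_nsets[of y "V - {x}" k] assms by (simp add: Diff_insert2[symmetric] insert_commute)
  finally show ?thesis by simp
qed

lemma wval_one: "wval (\<lambda>_. 1) F = real (card F)"
  by (simp add: wval_def)

text \<open>Expanding in \<open>u x\<close> and \<open>u y\<close>, the merged vertex reproduces the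
  constant and linear terms; only the product term is lost.\<close>

lemma wval_nsets_merge:
  assumes "finite V" "x \<in> V" "y \<in> V" "x \<noteq> y"
  shows "wval u ([V]\<^bsup>(k + 2)\<^esup>) =
    wval (u(x := u x + u y)) ([V - {y}]\<^bsup>(k + 2)\<^esup>) + u x * u y * wval u ([V - {x, y}]\<^bsup>k\<^esup>)"
proof -
  let ?R = "V - {x, y}" and ?v = "u(x := u x + u y)"
  have eq: "V - {y} - {x} = ?R" by auto
  have cong: "wval ?v ([?R]\<^bsup>m\<^esup>) = wval u ([?R]\<^bsup>m\<^esup>)" for m
    by (rule wval_cong) (auto simp: nsets_def)
  have x: "x \<in> V - {y}" "finite (V - {y})" using assms by auto
  have "wval u ([V]\<^bsup>Suc (Suc k)\<^esup>) = wval u ([V - {y}]\<^bsup>Suc (Suc k)\<^esup>) + u y * wval u ([V - {y}]\<^bsup>Suc k\<^esup>)"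
    using assms by (intro wval_nsets_peel)
  moreover have "wval u ([V - {y}]\<^bsup>Suc m\<^esup>) = wval u ([?R]\<^bsup>Suc m\<^esup>) + u x * wval u ([?R]\<^bsup>m\<^esup>)" for m
    using wval_nsets_peel[OF x(2,1), of u m] unfolding eq .
  moreover have "wval ?v ([V - {y}]\<^bsup>Suc (Suc k)\<^esup>)
      = wval u ([?R]\<^bsup>Suc (Suc k)\<^esup>) + (u x + u y) * wval u ([?R]\<^bsup>Suc k\<^esup>)"
    using wval_nsets_peel[OF x(2,1), of ?v "Suc k"] unfolding eq cong by simp
  ultimately show ?thesis by (simp add: algebra_simps)
qed

text \<open>Three points in a bounded set leave \<open>j\<close> free ones, one power of
  \<open>n\<close> short of the \<open>(n - 1) choose (j + 1)\<close> sets they are later compared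
  with.\<close>

lemma card_bad_bound:
  assumes "finite V" "card V = n + 1" "finite T" "real (card T) \<le> t"
    "t ^ 3 * real (n + 1) ^ j \<le> B"
  shows "real (card {f \<in> [V]\<^bsup>(j + 3)\<^esup>. 3 \<le> card (f \<inter> T)}) \<le> B"
proof -
  have "card {f \<in> [V]\<^bsup>(j + 3)\<^esup>. 3 \<le> card (f \<inter> T)} \<le> (card T choose 3) * (card V choose (j + 3 - 3))"
    using assms by (intro card_nsets_meeting)
  also have "\<dots> \<le> card T ^ 3 * (n + 1) ^ j"
    using binomial_le_power[of "card T" 3] binomial_le_power[of "n + 1" j] assms(2)
    by (intro mult_le_mono) auto
  finally have "real (card {f \<in> [V]\<^bsup>(j + 3)\<^esup>. 3 \<le> card (f \<inter> T)}) \<le> real (card T ^ 3 * (n + 1) ^ j)"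
    by (simp only: of_nat_le_iff)
  also have "\<dots> = real (card T) ^ 3 * real (n + 1) ^ j" by simp
  also have "\<dots> \<le> t ^ 3 * real (n + 1) ^ j" using assms(4) by (intro mult_right_mono power_mono) auto
  finally show ?thesis using assms(5) by linarith
qed

text \<open>Chebyshev's inequality. For \<open>E = 0\<close> all deviations vanish and the strict
  \<open><\<close> leaves the set empty.\<close>

lemma card_large_deviation:
  fixes d :: "'a \<Rightarrow> real"
  assumes "finite R" "(\<Sum>i\<in>R. (d i)\<^sup>2) \<le> E\<^sup>2" "0 < e" "0 \<le> E"
  shows "real (card {i\<in>R. e * E < \<bar>d i\<bar>}) \<le> 1 / e\<^sup>2"
proof (cases "E = 0")
  case True
  then have "(\<Sum>i\<in>R. (d i)\<^sup>2) = 0" using assms(2) by (simp add: order_antisym sum_nonneg)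
  then have none: "{i\<in>R. e * E < \<bar>d i\<bar>} = {}" using assms(1) True by (auto simp: sum_nonneg_eq_0_iff)
  show ?thesis unfolding none by simp
next
  case False
  let ?Bg = "{i\<in>R. e * E < \<bar>d i\<bar>}"
  have "real (card ?Bg) * (e * E)\<^sup>2 = (\<Sum>i\<in>?Bg. (e * E)\<^sup>2)" by simp
  also have "\<dots> \<le> (\<Sum>i\<in>?Bg. \<bar>d i\<bar>\<^sup>2)" using assms by (intro sum_mono power_mono) auto
  also have "\<dots> \<le> (\<Sum>i\<in>R. (d i)\<^sup>2)" using assms(1) by (simp add: sum_mono2)
  finally have "real (card ?Bg) * e\<^sup>2 * E\<^sup>2 \<le> E\<^sup>2" using assms(2) by (simp add: power_mult_distrib mult.assoc)
  then have "real (card ?Bg) * e\<^sup>2 \<le> 1" using False by (simp add: mult_le_cancel_right2)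
  then show ?thesis using assms(3) by (simp add: field_simps)
qed

text \<open>If \<open>x\<close> takes over the weight of the lightest vertex \<open>y\<close>, the complete graph loses exactly the
  sets through \<open>x\<close> and \<open>y\<close>. Each such set that is an edge is matched with a non-edge \<open>f\<close> of another
  kind. Dropping a vertex \<open>z\<close> from \<open>f\<close> leaves, unless \<open>f\<close> contains three exceptional vertices, at most
  one vertex whose weight deviates from 1 by more than \<open>e * E\<close>; so \<open>f\<close> weighs about \<open>u y * (1 - h)\<close> or
  more, whereas the matched set weighs about \<open>u y * u x\<close> and \<open>u x \<le> 1 - h\<close>.\<close>
lemma nonedges_weight:
  fixes u :: "nat \<Rightarrow> real"
  assumes V: "finite V" "card V = n + 1" and u: "\<And>i. i \<in> V \<Longrightarrow> 0 \<le> u i" "\<And>i. i \<in> V \<Longrightarrow> u i \<le> C"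
    and sum: "sum u V = real n" and n: "k + 2 \<le> n" "k = j + 1"
    and N: "N \<subseteq> [V]\<^bsup>(k + 2)\<^esup>" "(n - 1) choose k \<le> card N"
    and C: "1 \<le> C" and D: "D = (1 + C) ^ k * k + k + 1"
    and e: "0 < e" "4 * D * e \<le> 1"
    and B: "(1 / e\<^sup>2 + 2) ^ 3 * real (n + 1) ^ j \<le> e\<^sup>2 * real ((n - 1) choose k)"
    and M: "28 * D * e * real ((n - 1) choose k) * (real n * (real n - 1)) \<le> real (n choose (k + 2))"
  shows "wval u ([V]\<^bsup>(k + 2)\<^esup>) - wval u N \<le> real (n choose (k + 2))"
proof -
  have "V \<noteq> {}" using V(2) by auto
  then obtain y where y: "y \<in> V" "\<And>i. i \<in> V \<Longrightarrow> u y \<le> u i" using ex_min_on_finite[OF V(1)] by blast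
  have cVy: "card (V - {y}) = n" "finite (V - {y})" using V y by auto
  then have "V - {y} \<noteq> {}" using n by force
  then obtain x where x': "x \<in> V - {y}" "\<And>i. i \<in> V - {y} \<Longrightarrow> u x \<le> u i"
    using ex_min_on_finite[OF cVy(2)] by blast
  then have x: "x \<in> V" "x \<noteq> y" by auto
  define R where "R = V - {x, y}"
  have R: "finite R" "card R = n - 1" "R \<subseteq> V" "x \<notin> R" "y \<notin> R" "V = insert y (insert x R)"
    using V x y by (auto simp: R_def card_Diff_subset)
  have R0: "R \<noteq> {}" using R(2) n by auto
  have nonneg: "0 \<le> u i" if "f \<in> [V]\<^bsup>m\<^esup>" "i \<in> f" for f i m using that u by (auto simp: nsets_def)
  \<comment> \<open>The \<open>n\<close> vertices other than \<open>y\<close> have mass at most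
    \<open>n\<close>, and \<open>x\<close> is the lightest of them.\<close>
  have ux1: "u x \<le> 1"
  proof -
    have "real n * u x = (\<Sum>i\<in>V - {y}. u x)" using cVy by simp
    also have "\<dots> \<le> sum u (V - {y})" using x' by (intro sum_mono) auto
    also have "\<dots> \<le> real n" using V y u sum by (simp add: sum_diff1)
    finally show ?thesis using n by (simp add: mult_le_cancel_left1)
  qed
  define d where "d i = u i - 1" for i
  define p where "p i = max 0 (1 - u i)" for i
  \<comment> \<open>\<open>sg\<close> is the deviation of the vertex carrying the merged weight, so
    \<open>E^2\<close> is the squared deviation from 1 of the merged weighting.\<close>
  define sg where "sg = u x + u y - 1"
  define E where "E = sqrt (sg\<^sup>2 + (\<Sum>i\<in>R. (d i)\<^sup>2))"
  have S0: "0 \<le> (\<Sum>i\<in>R. (d i)\<^sup>2)" by (intro sum_nonneg) auto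
  have E: "0 \<le> E" "E\<^sup>2 = sg\<^sup>2 + (\<Sum>i\<in>R. (d i)\<^sup>2)" using S0 by (auto simp: E_def)
  have dE: "\<bar>d i\<bar> \<le> E" if "i \<in> R" for i
  proof -
    have "(d i)\<^sup>2 \<le> (\<Sum>i\<in>R. (d i)\<^sup>2)" using R(1) that by (intro member_le_sum) auto
    then have "(d i)\<^sup>2 \<le> E\<^sup>2" unfolding E(2) using zero_le_power2[of sg] by linarith
    then show ?thesis using E(1) by (simp add: abs_le_square_iff[symmetric])
  qed
  have sgE: "\<bar>sg\<bar> \<le> E"
  proof -
    have "sg\<^sup>2 \<le> E\<^sup>2" unfolding E(2) using S0 by linarith
    then show ?thesis using E(1) by (simp add: abs_le_square_iff[symmetric])
  qed
  define h where "h = Max (p ` R)"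
  have ph: "p i \<le> h" if "i \<in> R" for i using that R(1) by (simp add: h_def)
  have "h \<in> p ` R" unfolding h_def using R(1) R0 by (intro Max_in) auto
  then obtain i0 where i0: "i0 \<in> R" "h = p i0" by blast
  have pd: "p i \<le> \<bar>d i\<bar>" "0 \<le> p i" for i by (auto simp: p_def d_def)
  have h: "0 \<le> h" "h \<le> 1 - u x" "h \<le> E"
    using i0 pd[of i0] dE[OF i0(1)] ux1 x'(2)[of i0] R_def by (auto simp: p_def)

  \<comment> \<open>The exceptional vertices, at most \<open>1 / e^2\<close> of them. As
    \<open>T\<close> also has \<open>x\<close> and \<open>y\<close>, a set through both that is not
    in \<open>bad\<close> avoids \<open>Bg\<close>.\<close>
  define Bg where "Bg = {i\<in>R. e * E < \<bar>d i\<bar>}"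
  define T where "T = insert x (insert y Bg)"
  have Bg: "finite Bg" "Bg \<subseteq> R" using R by (auto simp: Bg_def)
  have "real (card Bg) \<le> 1 / e\<^sup>2"
    unfolding Bg_def using R e E zero_le_power2[of sg] by (intro card_large_deviation) auto
  moreover have "card T \<le> card Bg + 2"
    using Bg unfolding T_def by (simp add: card_insert_if)
  ultimately have T: "finite T" "real (card T) \<le> 1 / e\<^sup>2 + 2" using Bg by (auto simp: T_def)
  define bad where "bad = {f \<in> [V]\<^bsup>(k + 2)\<^esup>. 3 \<le> card (f \<inter> T)}"
  have finV: "finite ([V]\<^bsup>(k + 2)\<^esup>)" using V by (simp add: finite_imp_finite_nsets)
  have finbad: "finite bad" using finV by (simp add: bad_def)
  have jk: "k + 2 = j + 3" using n by simp
  have cbad: "real (card bad) \<le> e\<^sup>2 * real ((n - 1) choose k)"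
    unfolding bad_def jk by (rule card_bad_bound[OF V T B])

  define P where "P = {f \<in> [V]\<^bsup>(k + 2)\<^esup>. x \<in> f \<and> y \<in> f}"
  define M0 where "M0 = real ((n - 1) choose k)"
  have M0: "0 < M0" using n by (simp add: M0_def)
  have finP: "finite P" "finite N" using finV N finite_subset by (auto simp: P_def)
  have wP: "wval v P = v x * v y * wval v ([R]\<^bsup>k\<^esup>)" for v
    unfolding P_def R_def using wval_pair_star[OF V(1) x(1) y(1) x(2)] .
  have cP: "card P = (n - 1) choose k"
    using wP[of "\<lambda>_. 1"] R card_nsets_finite[OF R(1)] by (simp add: wval_one)
  \<comment> \<open>\<open>N\<close> holds missing sets, so \<open>Q\<close> are the pair sets still
    present. Since \<open>N\<close> is at least as large as \<open>P\<close>, equally many missing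
    sets \<open>N'\<close> exist outside \<open>P\<close>.\<close>
  define Q where "Q = P - N"
  define q where "q = card Q"
  have "q \<le> card (N - P)" unfolding q_def Q_def using finP N cP by (intro card_le_sym_Diff) auto
  then obtain N' where N': "N' \<subseteq> N - P" "card N' = q" using obtain_subset_with_card_n by blast
  have fin: "finite Q" "finite N'" using finP N' finite_subset by (auto simp: Q_def)
  have qM0: "real q \<le> M0"
    using card_mono[OF finP(1), of Q] cP by (auto simp: q_def Q_def M0_def)

  \<comment> \<open>In \<open>D\<close>, \<open>(1 + C) ^ k * k\<close> serves the upper estimate of
    products and \<open>k + 1\<close> the lower one. Bad sets may err by order \<open>E\<close>
    because they are few.\<close>
  define err where "err f = D * (e * E + (if f \<in> bad then E else 0))" for f
  have D1: "1 \<le> D" "0 \<le> (1 + C) ^ k * real k" unfolding D using C by auto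
  have Qf: "(\<Prod>i\<in>f. u i) \<le> u y * (1 - (1 - u x) + err f)" if f: "f \<in> Q" for f
  proof -
    define A where "A = f - {x, y}"
    have f': "f \<subseteq> V" "finite f" "card f = k + 2" "x \<in> f" "y \<in> f"
      using f by (auto simp: Q_def P_def nsets_def)
    have A: "f = insert x (insert y A)" "A \<subseteq> R" "finite A" "x \<notin> A" "y \<notin> A"
      using f' by (auto simp: A_def R_def)
    then have cA: "card A = k" using f'(3) x by simp
    have dA: "\<bar>d i\<bar> \<le> e * E + (if f \<in> bad then E else 0)" if i: "i \<in> A" for i
    proof (cases "f \<in> bad")
      case True
      have "\<bar>d i\<bar> \<le> E" using dE i A(2) by blast
      moreover have "0 \<le> e * E" using E e by simp
      ultimately show ?thesis using True by simp
    next
      case False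
      have "i \<notin> Bg"
      proof
        assume "i \<in> Bg"
        then have "{x, y, i} \<subseteq> f \<inter> T" using i A by (auto simp: T_def)
        then have "card {x, y, i} \<le> card (f \<inter> T)" using f' by (intro card_mono) auto
        moreover have "x \<noteq> i" "y \<noteq> i" using i A(4,5) by auto
        then have "card {x, y, i} = 3" using x(2) by simp
        ultimately show False using False f by (auto simp: bad_def Q_def P_def)
      qed
      then show ?thesis using False i A by (auto simp: Bg_def not_less)
    qed
    have "(\<Prod>i\<in>A. u i) \<le> (\<Prod>i\<in>A. 1 + \<bar>d i\<bar>)"
      using A R u by (intro prod_mono) (auto simp: d_def)
    also have "\<dots> \<le> 1 + (1 + C) ^ card A * (\<Sum>i\<in>A. \<bar>d i\<bar>)"
    proof (rule prod_one_plus_le)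
      fix i assume "i \<in> A"
      then have "0 \<le> u i" "u i \<le> C" using u A R by auto
      then show "\<bar>d i\<bar> \<le> C" using C by (auto simp: d_def)
    qed (use A C in auto)
    also have "(\<Sum>i\<in>A. \<bar>d i\<bar>) \<le> (\<Sum>i\<in>A. e * E + (if f \<in> bad then E else 0))"
      using dA by (rule sum_mono)
    also have "\<dots> = real k * (e * E + (if f \<in> bad then E else 0))" using cA by simp
    also have "1 + (1 + C) ^ card A * (real k * (e * E + (if f \<in> bad then E else 0)))
        = 1 + ((1 + C) ^ k * real k) * (e * E + (if f \<in> bad then E else 0))" using cA by simp
    also have "\<dots> \<le> 1 + err f"
      unfolding err_def using E e D C by (intro add_left_mono mult_right_mono) auto
    finally have PA: "(\<Prod>i\<in>A. u i) \<le> 1 + err f" using C by (simp add: mult_left_mono)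
    have "(\<Prod>i\<in>f. u i) = u y * (u x * (\<Prod>i\<in>A. u i))"
      using A x by (simp add: mult.left_commute)
    also have "\<dots> \<le> u y * (u x * (1 + err f))"
      using PA u x y by (intro mult_left_mono) auto
    also have "\<dots> \<le> u y * (1 - (1 - u x) + err f)"
    proof (intro mult_left_mono)
      have "0 \<le> err f" using E e D1 by (auto simp: err_def)
      then have "u x * err f \<le> 1 * err f" using ux1 by (intro mult_right_mono)
      then show "u x * (1 + err f) \<le> 1 - (1 - u x) + err f" by (simp add: algebra_simps)
    qed (use u y in auto)
    finally show ?thesis .
  qed
  have Nf: "u y * (1 - h - err f) \<le> (\<Prod>i\<in>f. u i)" if f: "f \<in> N'" for f
  proof -
    have fN: "f \<in> [V]\<^bsup>(k + 2)\<^esup>" "\<not> (x \<in> f \<and> y \<in> f)" using f N' N by (auto simp: P_def)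
    then have f': "f \<subseteq> V" "finite f" "card f = k + 2" by (auto simp: nsets_def)
    \<comment> \<open>\<open>f\<close> contains at most one of \<open>x\<close> and
      \<open>y\<close>; that one is dropped, or else a vertex in \<open>T\<close> if there is one.
      Outside \<open>bad\<close> at most two vertices of \<open>f\<close> lie in \<open>T\<close>,
      so at most one is left.\<close>
    obtain z where z: "z \<in> f" "x \<notin> f - {z}" "y \<notin> f - {z}" "f \<notin> bad \<Longrightarrow> card ((f - {z}) \<inter> T) \<le> 1"
    proof (cases "f \<inter> T = {}")
      case True
      obtain z where "z \<in> f" using f'(3) by fastforce
      moreover have "(f - {z}) \<inter> T = {}" "x \<notin> f" "y \<notin> f" using True by (auto simp: T_def)
      ultimately show thesis using that by simp
    next
      case False
      then obtain z where z: "z \<in> f \<inter> T" "x \<notin> f - {z}" "y \<notin> f - {z}"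
        using fN(2) by (cases "x \<in> f"; cases "y \<in> f"; auto simp: T_def)
      have "(f - {z}) \<inter> T = (f \<inter> T) - {z}" by auto
      then have "card ((f - {z}) \<inter> T) \<le> 1" if "f \<notin> bad"
        using z f' that fN by (simp add: bad_def)
      then show thesis using that z by blast
    qed
    define A where "A = f - {z}"
    have A: "A \<subseteq> R" "finite A" "card A = k + 1" "f = insert z A" "z \<notin> A"
      using f' z by (auto simp: A_def R_def)
    have pA: "(\<Sum>i\<in>A. p i) \<le> h + err f"
    proof (cases "f \<in> bad")
      case True
      have "(\<Sum>i\<in>A. p i) \<le> (\<Sum>i\<in>A. e * E + E)"
      proof (rule sum_mono)
        fix i assume "i \<in> A"
        then have "p i \<le> E" using dE[of i] pd(1)[of i] A(1) by force
        then show "p i \<le> e * E + E" using e E by (simp add: add_increasing)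
      qed
      also have "\<dots> = (real k + 1) * (e * E + E)" using A by simp
      also have "\<dots> \<le> D * (e * E + E)" using e E D D1 by (intro mult_right_mono) auto
      finally show ?thesis using True h by (simp add: err_def)
    next
      case False
      have "(\<Sum>i\<in>A. p i) = (\<Sum>i\<in>A \<inter> Bg. p i) + (\<Sum>i\<in>A - Bg. p i)"
        using A by (simp add: sum.Int_Diff)
      \<comment> \<open>The one remaining exceptional vertex is charged \<open>h\<close> rather than
        \<open>E\<close>, so that the loss can be set against the deficit
        \<open>1 - u x\<close>.\<close>
      also have "(\<Sum>i\<in>A \<inter> Bg. p i) \<le> (\<Sum>i\<in>A \<inter> Bg. h)"
        using ph A by (intro sum_mono) auto
      also have "\<dots> \<le> h"
      proof -
        have "card (A \<inter> Bg) \<le> card (A \<inter> T)" using A by (intro card_mono) (auto simp: T_def)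
        then have "real (card (A \<inter> Bg)) \<le> 1" using z(4)[OF False] by (simp add: A_def)
        then show ?thesis using h mult_right_mono[of "real (card (A \<inter> Bg))" 1 h] by simp
      qed
      also have "(\<Sum>i\<in>A - Bg. p i) \<le> (\<Sum>i\<in>A - Bg. e * E)"
      proof (rule sum_mono)
        fix i assume "i \<in> A - Bg"
        then have "\<bar>d i\<bar> \<le> e * E" using A by (auto simp: Bg_def not_less)
        then show "p i \<le> e * E" using pd(1)[of i] by linarith
      qed
      also have "\<dots> = real (card (A - Bg)) * (e * E)" by simp
      also have "\<dots> \<le> D * (e * E)"
      proof (intro mult_right_mono)
        have "card (A - Bg) \<le> k + 1" using A card_mono[of A "A - Bg"] by auto
        then have "real (card (A - Bg)) \<le> real k + 1" by linarith
        then show "real (card (A - Bg)) \<le> D" using D D1 by linarith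
      qed (use e E in simp)
      finally show ?thesis using False by (simp add: err_def)
    qed
    have A0: "0 \<le> (\<Prod>i\<in>A. u i)" using A R u by (intro prod_nonneg) auto
    have "1 - (\<Sum>i\<in>A. p i) \<le> (\<Prod>i\<in>A. u i)"
      unfolding p_def using A R u by (intro prod_ge_one_minus_sum) auto
    then have "1 - h - err f \<le> (\<Prod>i\<in>A. u i)" using pA by linarith
    then have "u y * (1 - h - err f) \<le> u y * (\<Prod>i\<in>A. u i)" using u y by (intro mult_left_mono) auto
    also have "\<dots> \<le> u z * (\<Prod>i\<in>A. u i)" using y z f' A0 by (intro mult_right_mono) auto
    also have "\<dots> = (\<Prod>i\<in>f. u i)" using A by simp
    finally show ?thesis .
  qed

  define b where "b = min (real q) (e\<^sup>2 * M0)"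
  have err_sum: "(\<Sum>f\<in>F. err f) \<le> D * E * (real q * e + b)" if F: "finite F" "card F = q" for F
  proof -
    have "(\<Sum>f\<in>F. err f) = D * E * (real q * e + real (card (F \<inter> bad)))"
      using F by (simp add: err_def sum.distrib sum.If_cases flip: sum_distrib_left)
        (simp add: algebra_simps)
    moreover have "real (card (F \<inter> bad)) \<le> b"
    proof -
      have "card (F \<inter> bad) \<le> card F" "card (F \<inter> bad) \<le> card bad"
        using F finbad by (auto intro: card_mono)
      then show ?thesis using cbad F by (auto simp: b_def M0_def)
    qed
    ultimately show ?thesis using D1 E by (simp add: mult_left_mono)
  qed
  have "wval u Q \<le> (\<Sum>f\<in>Q. u y * (1 - (1 - u x) + err f))"
    unfolding wval_def using Qf by (rule sum_mono)
  also have "\<dots> = u y * (real q * (1 - (1 - u x)) + (\<Sum>f\<in>Q. err f))"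
    by (simp add: q_def sum.distrib flip: sum_distrib_left)
  also have "\<dots> \<le> u y * (real q * (1 - (1 - u x)) + D * E * (real q * e + b))"
    using err_sum[OF fin(1)] u y by (intro mult_left_mono) (auto simp: q_def)
  finally have Qle: "wval u Q \<le> u y * (real q * (1 - (1 - u x)) + D * E * (real q * e + b))" .
  have "u y * (real q * (1 - h) - D * E * (real q * e + b)) \<le> u y * (real q * (1 - h) - (\<Sum>f\<in>N'. err f))"
    using err_sum[OF fin(2) N'(2)] u y by (intro mult_left_mono) auto
  also have "\<dots> = (\<Sum>f\<in>N'. u y * (1 - h - err f))"
    using N'(2) by (simp add: sum_subtractf flip: sum_distrib_left)
  also have "\<dots> \<le> wval u N'" unfolding wval_def using Nf by (rule sum_mono)
  finally have Nge: "u y * (real q * (1 - h) - D * E * (real q * e + b)) \<le> wval u N'" .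

  \<comment> \<open>Since \<open>b\<close> is the smaller of \<open>s^2 * M0\<close> and
    \<open>e^2 * M0\<close>, it is at most \<open>e * s * M0\<close>. The factor \<open>s\<close> is
    what \<open>deficit_inequality\<close> needs.\<close>
  define s where "s = sqrt (real q / M0)"
  have s: "0 \<le> s" "s \<le> 1" "s\<^sup>2 * M0 = real q" using M0 qM0 by (auto simp: s_def)
  have "real q * e + b \<le> 2 * e * s * M0"
  proof -
    have "s\<^sup>2 \<le> s" using s mult_left_mono[of s 1 s] by (simp add: power2_eq_square)
    then have "s\<^sup>2 * M0 * e \<le> s * M0 * e" using M0 e by (intro mult_right_mono) auto
    then have "real q * e \<le> e * s * M0" unfolding s(3) by (simp only: mult_ac)
    moreover have "b \<le> e * s * M0"
    proof (cases "s \<le> e")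
      case True
      have "b \<le> s * (s * M0)" using s(3) by (simp add: b_def power2_eq_square mult.assoc)
      also have "\<dots> \<le> e * (s * M0)" using True s M0 by (intro mult_right_mono) auto
      finally show ?thesis by simp
    next
      case False
      have "b \<le> e * (e * M0)" by (simp add: b_def power2_eq_square mult.assoc)
      also have "\<dots> \<le> e * (s * M0)" using False e M0 by (intro mult_left_mono mult_right_mono) auto
      finally show ?thesis by simp
    qed
    ultimately show ?thesis by linarith
  qed
  then have "D * E * (real q * e + b) \<le> D * E * (2 * e * s * M0)"
    using D1 E by (intro mult_left_mono) auto
  then have "real q * (h - (1 - u x)) + 2 * (D * E * (real q * e + b))
      \<le> s\<^sup>2 * M0 * (h - (1 - u x)) + 2 * (D * E * (2 * e * s * M0))"
    unfolding s(3) by linarith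
  then have "u y * (real q * (h - (1 - u x)) + 2 * (D * E * (real q * e + b)))
      \<le> u y * (s\<^sup>2 * M0 * (h - (1 - u x)) + 2 * (D * E * (2 * e * s * M0)))"
    using u y(1) by (intro mult_left_mono)
  moreover have "wval u Q - wval u N' \<le> u y * (real q * (h - (1 - u x)) + 2 * (D * E * (real q * e + b)))"
    using Qle Nge by (simp add: algebra_simps)
  ultimately have "wval u Q - wval u N'
      \<le> M0 * ((1 - u x + sg) * (s\<^sup>2 * (h - (1 - u x)) + (4 * D * e) * s * E))"
    by (simp add: sg_def algebra_simps)
  \<comment> \<open>Here \<open>a\<close> is \<open>1 - u x\<close>, so that
    \<open>a + sg = u y\<close>, and \<open>4 * D * e\<close> stands for the \<open>e\<close> of
    \<open>deficit_inequality\<close>.\<close>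
  also have "\<dots> \<le> M0 * (7 * (4 * D * e) * E\<^sup>2)"
  proof (intro mult_left_mono deficit_inequality)
    show "0 \<le> 1 - u x + sg" using u y by (simp add: sg_def)
  qed (use h s e D1 sgE M0 in auto)
  finally have diff: "wval u Q - wval u N' \<le> 28 * D * e * M0 * E\<^sup>2" by (simp add: algebra_simps)

  have nn: "0 < real n * (real n - 1)" using n by simp
  have "wval u ([V]\<^bsup>(k + 2)\<^esup>) = wval (u(x := u x + u y)) ([V - {y}]\<^bsup>(k + 2)\<^esup>) + wval u P"
    using wval_nsets_merge[OF V(1) x(1) y(1) x(2), of u k] wP[of u] by (simp add: R_def)
  moreover have "wval (u(x := u x + u y)) ([V - {y}]\<^bsup>(k + 2)\<^esup>)
      \<le> real (n choose (k + 2)) * (1 - E\<^sup>2 / (real n * (real n - 1)))"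
  proof -
    let ?v = "u(x := u x + u y)"
    have Vy: "V - {y} = insert x R" using R x by auto
    have vR: "(\<Sum>i\<in>R. g (?v i)) = (\<Sum>i\<in>R. g (u i))" for g :: "real \<Rightarrow> real"
      using R by (intro sum.cong) auto
    have "sum ?v (V - {y}) = real (card (V - {y}))"
    proof -
      have "sum u V = u y + (u x + sum u R)" using R x by simp
      then show ?thesis using vR[of "\<lambda>t. t"] R sum cVy unfolding Vy by simp
    qed
    moreover have "(\<Sum>i\<in>V - {y}. (?v i - 1)\<^sup>2) = E\<^sup>2"
      using vR[of "\<lambda>t. (t - 1)\<^sup>2"] R unfolding Vy E(2) by (simp add: sg_def d_def)
    moreover have "0 \<le> ?v i" if "i \<in> V - {y}" for i using that u x y by auto
    ultimately show ?thesis
      using maclaurin_stability[OF cVy(2), of ?v "k + 2"] cVy n by simp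
  qed
  moreover have "wval u P = wval u (P \<inter> N) + wval u Q"
    using wval_split[OF finP(1), of "P \<inter> N" u] by (simp add: Q_def Diff_Int)
  moreover have "wval u (P \<inter> N) + wval u N' \<le> wval u N"
  proof -
    have "wval u (P \<inter> N) + wval u (N - P) = wval u N"
      using wval_split[OF finP(2), of "P \<inter> N" u] by (simp add: Diff_Int)
    moreover have "wval u N' \<le> wval u (N - P)"
      using finP N' N nonneg by (intro wval_mono) auto
    ultimately show ?thesis by linarith
  qed
  moreover have "28 * D * e * M0 * E\<^sup>2 \<le> real (n choose (k + 2)) * (E\<^sup>2 / (real n * (real n - 1)))"
  proof -
    have "28 * D * e * M0 \<le> real (n choose (k + 2)) / (real n * (real n - 1))"
      using M nn by (simp add: M0_def pos_le_divide_eq)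
    then have "28 * D * e * M0 * E\<^sup>2 \<le> real (n choose (k + 2)) / (real n * (real n - 1)) * E\<^sup>2"
      by (intro mult_right_mono) auto
    then show ?thesis by simp
  qed
  ultimately show ?thesis using diff by (simp add: algebra_simps)
qed

section \<open>The Lagrangian\<close>

text \<open>The stability condition fixes \<open>e\<close> in terms of \<open>C\<close> and
  \<open>k\<close> alone. The number of exceptional vertices is then a constant, and the condition
  on bad sets holds for large \<open>n\<close>.\<close>

lemma nonedges_weight_eventually:
  assumes C: "1 \<le> C" and k: "k = j + 1"
  shows "\<exists>n0. \<forall>n\<ge>n0. \<forall>V N u. finite V \<and> card V = n + 1 \<and> (\<forall>i\<in>V. 0 \<le> u i \<and> u i \<le> C) \<and>
    sum u V = real n \<and> N \<subseteq> [V]\<^bsup>(k + 2)\<^esup> \<and> (n - 1) choose k \<le> card N \<longrightarrow>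
    wval u ([V]\<^bsup>(k + 2)\<^esup>) - wval u N \<le> real (n choose (k + 2))"
proof -
  define D where "D = (1 + C) ^ k * real k + real k + 1"
  define R where "R = real (k + 2) * real (k + 1)"
  \<comment> \<open>\<open>R * (n choose (k + 2))\<close> is
    \<open>n * (n - 1) * ((n - 2) choose k)\<close>, and \<open>(n - 1) choose k\<close> is at most
    twice \<open>(n - 2) choose k\<close> once \<open>n - 1 \<ge> 2 * k\<close>; hence 56 = 28 *
    2.\<close>
  define e where "e = 1 / (56 * D * R)"
  define t where "t = (1 / e\<^sup>2 + 2) ^ 3"
  \<comment> \<open>The condition on bad sets solved for \<open>n - 1\<close> by
    \<open>binomial_lower_bound\<close>; \<open>3 ^ j\<close> comes from
    \<open>n + 1 \<le> 3 * (n - 1)\<close>.\<close>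
  define B0 where "B0 = real (Suc j choose 2) + t * 3 ^ j * fact (Suc j) / e\<^sup>2"
  have D: "1 \<le> D" using C by (simp add: D_def)
  have "1 * 1 \<le> real (k + 2) * real (k + 1)" by (intro mult_mono) auto
  then have R: "1 \<le> R" by (simp add: R_def)
  have DR: "0 < D * R" "1 \<le> R" using D R by auto
  have e: "0 < e" "28 * D * e * R = 1 / 2" using D R by (auto simp: e_def)
  have e4: "4 * D * e \<le> 1"
  proof -
    have "28 * D * e * 1 \<le> 28 * D * e * R" using R D e(1) by (intro mult_left_mono) auto
    then show ?thesis using e(2) by simp
  qed
  have t: "0 \<le> t" by (simp add: t_def)
  obtain n0 :: nat where n0: "B0 < real n0" using reals_Archimedean2 by blast
  show ?thesis
  proof (intro exI[of _ "n0 + 2 * k + 3"] allI impI)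
    fix n V N and u :: "nat \<Rightarrow> real"
    assume n: "n0 + 2 * k + 3 \<le> n" and h: "finite V \<and> card V = n + 1 \<and> (\<forall>i\<in>V. 0 \<le> u i \<and> u i \<le> C) \<and>
      sum u V = real n \<and> N \<subseteq> [V]\<^bsup>(k + 2)\<^esup> \<and> (n - 1) choose k \<le> card N"
    define m where "m = n - 1"
    have m: "n = m + 1" "real n0 \<le> real m" "2 * k \<le> m" "0 < m" using n by (auto simp: m_def)
    have half: "real (m choose k) \<le> 2 * real ((m - 1) choose k)"
    proof -
      have "m * (m choose k) \<le> 2 * (m - k) * (m choose k)" using m by (intro mult_right_mono) auto
      also have "\<dots> = m * (2 * ((m - 1) choose k))"
        using binomial_absorb_comp[of m k] by (simp add: mult.assoc mult.left_commute)
      finally have "(m choose k) \<le> 2 * ((m - 1) choose k)" using m by simp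
      then show ?thesis by linarith
    qed
    have "(k + 2) * (k + 1) * (n choose (k + 2)) = n * (n - 1) * ((m - 1) choose k)"
    proof -
      have "(k + 2) * (n choose (k + 2)) = n * (m choose (k + 1))"
        using binomial_absorption[of "k + 1" n] m(1) by simp
      moreover have "(k + 1) * (m choose (k + 1)) = m * ((m - 1) choose k)"
        using binomial_absorption[of k m] by simp
      ultimately show ?thesis using m(1)
        by (metis add_diff_cancel_right' mult.assoc mult.left_commute)
    qed
    then have "real ((k + 2) * (k + 1) * (n choose (k + 2))) = real (n * (n - 1) * ((m - 1) choose k))"
      by (rule arg_cong)
    then have bin: "R * real (n choose (k + 2)) = real n * (real n - 1) * real ((m - 1) choose k)"
      using m by (simp add: R_def algebra_simps)
    have M: "28 * D * e * real ((n - 1) choose k) * (real n * (real n - 1)) \<le> real (n choose (k + 2))"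
    proof -
      have "28 * D * e * real (m choose k) * (real n * (real n - 1)) \<le>
          28 * D * e * (2 * real ((m - 1) choose k)) * (real n * (real n - 1))"
        using half D e m by (intro mult_right_mono mult_left_mono) auto
      also have "\<dots> = 2 * (28 * D * e) * (R * real (n choose (k + 2)))"
        unfolding bin by simp
      also have "\<dots> = 2 * (28 * D * e * R) * real (n choose (k + 2))" by (simp only: mult_ac)
      also have "\<dots> = real (n choose (k + 2))" unfolding e(2) by simp
      finally show ?thesis by (simp add: m_def)
    qed
    have B: "(1 / e\<^sup>2 + 2) ^ 3 * real (n + 1) ^ j \<le> e\<^sup>2 * real ((n - 1) choose k)"
    proof -
      define p where "p = real m ^ j"
      have e2: "0 < e\<^sup>2" using e by simp
      have p: "0 < p" using m by (simp add: p_def)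
      have "B0 \<le> real m" using n0 m by linarith
      then have "e\<^sup>2 * (B0 * p) \<le> e\<^sup>2 * (real m * p)" using p e2 by (intro mult_left_mono mult_right_mono) auto
      moreover have "e\<^sup>2 * (B0 * p) = e\<^sup>2 * (real (Suc j choose 2) * p) + t * 3 ^ j * fact (Suc j) * p"
      proof -
        have "x * ((a + b / x) * p) = x * (a * p) + b * p" if "0 < x" for x a b :: real
          using that by (simp add: field_simps)
        from this[OF e2] show ?thesis unfolding B0_def .
      qed
      moreover have "e\<^sup>2 * (real m * p - real (Suc j choose 2) * p) \<le> e\<^sup>2 * (fact (Suc j) * real (m choose Suc j))"
        using binomial_lower_bound[of m j] e2 by (intro mult_left_mono) (auto simp: p_def)
      ultimately have "fact (Suc j) * (t * 3 ^ j * p) \<le> fact (Suc j) * (e\<^sup>2 * real (m choose Suc j))"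
        by (simp only: right_diff_distrib mult_ac)
      then have "t * (3 ^ j * p) \<le> e\<^sup>2 * real (m choose Suc j)"
        by (simp only: mult_le_cancel_left_pos[OF fact_gt_zero] mult.assoc)
      moreover have "real (n + 1) ^ j \<le> 3 ^ j * p"
      proof -
        have "real (n + 1) ^ j \<le> (3 * real m) ^ j" using m by (intro power_mono) auto
        then show ?thesis by (simp add: p_def power_mult_distrib)
      qed
      then have "t * real (n + 1) ^ j \<le> t * (3 ^ j * p)" using t by (rule mult_left_mono)
      ultimately show ?thesis using k by (simp add: t_def m_def)
    qed
    show "wval u ([V]\<^bsup>(k + 2)\<^esup>) - wval u N \<le> real (n choose (k + 2))"
    proof (rule nonedges_weight[OF _ _ _ _ _ _ k _ _ C D_def e(1) e4 B M])
      show "finite V" "card V = n + 1" "sum u V = real n" "N \<subseteq> [V]\<^bsup>(k + 2)\<^esup>"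
        "(n - 1) choose k \<le> card N" using h by simp_all
      show "0 \<le> u i" "u i \<le> C" if "i \<in> V" for i using h that by blast+
      show "k + 2 \<le> n" using n by simp
    qed
  qed
qed

text \<open>As \<open>stationary\<close> contains the opposite inequality, this rules out strict
  violations.\<close>

lemma stationary_wval_le:
  assumes k: "k = j + 1"
  shows "\<exists>n0. \<forall>n\<ge>n0. \<forall>V G u. stationary (k + 2) n V G u \<and>
     card G \<le> (n choose (k + 2)) + ((n - 1) choose (k + 1)) \<longrightarrow> wval u G \<le> real (n choose (k + 2))"
proof -
  define C where "C = real ((k + 2) choose 2)"
  have "1 \<le> (k + 2) choose 2" using zero_less_binomial[of 2 "k + 2"] by linarith
  then have C: "1 \<le> C" unfolding C_def by (metis of_nat_1 of_nat_le_iff)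
  obtain n1 where n1: "\<forall>n\<ge>n1. \<forall>V N u. finite V \<and> card V = n + 1 \<and> (\<forall>i\<in>V. 0 \<le> u i \<and> u i \<le> C) \<and>
    sum u V = real n \<and> N \<subseteq> [V]\<^bsup>(k + 2)\<^esup> \<and> (n - 1) choose k \<le> card N \<longrightarrow>
    wval u ([V]\<^bsup>(k + 2)\<^esup>) - wval u N \<le> real (n choose (k + 2))"
    using nonedges_weight_eventually[OF C k] by (rule exE)
  obtain n2 where n2: "\<forall>n\<ge>n2. \<forall>V G u. stationary (k + 2) n V G u \<and>
     card G \<le> (n choose (k + 2)) + ((n - 1) choose (k + 1)) \<longrightarrow> card V \<le> n + 1"
    using stationary_card[of k] by (rule exE)
  show ?thesis
  proof (intro exI[of _ "n1 + n2 + k + 2"] allI impI)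
    fix n V G u
    assume n: "n1 + n2 + k + 2 \<le> n" and h: "stationary (k + 2) n V G u \<and>
     card G \<le> (n choose (k + 2)) + ((n - 1) choose (k + 1))"
    have V: "finite V" "\<forall>i\<in>V. 0 < u i" "sum u V = real n" "G \<subseteq> [V]\<^bsup>(k + 2)\<^esup>"
      using h by (auto simp: stationary_def)
    have fin: "finite ([V]\<^bsup>(k + 2)\<^esup>)" using V by (simp add: finite_imp_finite_nsets)
    have "card V \<le> n + 1" using n2[rule_format, of n V G u] h n by linarith
    then consider "card V \<le> n" | "card V = n + 1" by linarith
    then show "wval u G \<le> real (n choose (k + 2))"
    proof cases
      case 1
      \<comment> \<open>Zero weights pad the support to exactly \<open>n\<close> vertices, so that
        mass and number of vertices agree for Maclaurin's inequality.\<close>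
      have "n \<le> card (V \<union> {..<n})" using card_mono[of "V \<union> {..<n}" "{..<n}"] V by simp
      then obtain V' where V': "V \<subseteq> V'" "V' \<subseteq> V \<union> {..<n}" "card V' = n"
        using exists_subset_between[of V n "V \<union> {..<n}"] 1 V by auto
      then have fV': "finite V'" using V by (meson finite_UnI finite_lessThan finite_subset)
      define v where "v i = (if i \<in> V then u i else 0)" for i
      have v0: "0 \<le> v i" for i using V by (auto simp: v_def intro: less_imp_le)
      have "sum v V' = sum v V" using V' fV' by (intro sum.mono_neutral_right) (auto simp: v_def)
      also have "\<dots> = sum u V" by (simp add: v_def)
      finally have s: "sum v V' = real (card V')" using V V' by simp
      have "wval u G = wval v G" using V(4) by (intro wval_cong) (auto simp: v_def nsets_def)
      also have "\<dots> \<le> wval v ([V']\<^bsup>(k + 2)\<^esup>)"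
        using V(4) V'(1) v0 fV' by (intro wval_mono finite_imp_finite_nsets) (auto simp: nsets_def)
      also have "\<dots> \<le> real (n choose (k + 2)) *
          (1 - (\<Sum>i\<in>V'. (v i - 1)\<^sup>2) / (real n * (real n - 1)))"
        using maclaurin_stability[OF fV' v0 s, of "k + 2"] V' n by simp
      also have "\<dots> \<le> real (n choose (k + 2)) * 1"
        using n by (intro mult_left_mono) (auto intro!: divide_nonneg_nonneg sum_nonneg)
      finally show ?thesis by simp
    next
      case 2
      let ?N = "[V]\<^bsup>(k + 2)\<^esup> - G"
      have "card ?N = ((n + 1) choose (k + 2)) - card G"
        using V fin by (simp add: card_Diff_subset card_nsets_finite 2 finite_subset[OF V(4) fin])
      \<comment> \<open>Pascal's rule twice: at least \<open>(n - 1) choose k\<close> sets are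
        missing, as many as contain a fixed pair of vertices.\<close>
      moreover have "(n + 1) choose (k + 2) = (n choose (k + 2)) + (((n - 1) choose (k + 1)) + ((n - 1) choose k))"
        using n by (cases n) auto
      ultimately have "(n - 1) choose k \<le> card ?N" using h by linarith
      moreover have "\<forall>i\<in>V. 0 \<le> u i \<and> u i \<le> C"
        using V stationary_weight_le[of k n V G u] h n unfolding C_def by (auto intro: less_imp_le)
      ultimately have "wval u ([V]\<^bsup>(k + 2)\<^esup>) - wval u ?N \<le> real (n choose (k + 2))"
        using n1[rule_format, of n V u ?N] V 2 n by auto
      then show ?thesis using wval_split[OF fin V(4), of u] by simp
    qed
  qed
qed

text \<open>Passing to a maximiser and its support makes all weights positive, as the multiplier
  equations require. Edges may be lost on the way, which is why edge counts are only bounded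
  above.\<close>

lemma simplex_wval_le:
  assumes k: "k = j + 1"
  shows "\<exists>n0. \<forall>n\<ge>n0. \<forall>W F u. finite W \<and> (\<forall>f\<in>F. f \<subseteq> W \<and> card f = k + 2) \<and>
     card F \<le> (n choose (k + 2)) + ((n - 1) choose (k + 1)) \<and> u \<in> simplex W (real n) \<longrightarrow>
     wval u F \<le> real (n choose (k + 2))"
proof -
  obtain n0 where n0: "\<forall>n\<ge>n0. \<forall>V G u. stationary (k + 2) n V G u \<and>
     card G \<le> (n choose (k + 2)) + ((n - 1) choose (k + 1)) \<longrightarrow> wval u G \<le> real (n choose (k + 2))"
    using stationary_wval_le[OF k] by (rule exE)
  show ?thesis
  proof (intro exI[of _ n0] allI impI)
    fix n W F u0
    assume n: "n0 \<le> n" and h: "finite W \<and> (\<forall>f\<in>F. f \<subseteq> W \<and> card f = k + 2) \<and>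
     card F \<le> (n choose (k + 2)) + ((n - 1) choose (k + 1)) \<and> u0 \<in> simplex W (real n)"
    then have W: "finite W" "\<And>f. f \<in> F \<Longrightarrow> f \<subseteq> W \<and> card f = k + 2"
      and card: "card F \<le> (n choose (k + 2)) + ((n - 1) choose (k + 1))"
      and u0: "u0 \<in> simplex W (real n)" by auto
    have finF: "finite F" using W by (auto intro: finite_subset[of _ "Pow W"])
    obtain u where u: "u \<in> simplex W (real n)" and max: "\<And>v. v \<in> simplex W (real n) \<Longrightarrow> wval v F \<le> wval u F"
      using wval_attains_sup[OF W(1), of "real n" F] u0 by blast
    have u': "\<And>i. 0 \<le> u i" "\<And>i. i \<notin> W \<Longrightarrow> u i = 0" "sum u W = real n"
      using u by (auto simp: simplex_def)
    define V where "V = {i\<in>W. 0 < u i}"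
    define G where "G = {f\<in>F. f \<subseteq> V}"
    have GF: "G \<subseteq> F" "finite G" using finF by (auto simp: G_def)
    have V: "finite V" "V \<subseteq> W" using W by (auto simp: V_def)
    have zero: "u i = 0" if "i \<notin> V" for i
      using that u'(1)[of i] u'(2)[of i] by (auto simp: V_def)
    have eq: "wval u G = wval u F"
      unfolding wval_def
    proof (intro sum.mono_neutral_left finF GF ballI)
      fix f assume f: "f \<in> F - G"
      then obtain i where i: "i \<in> f" "i \<notin> V" by (auto simp: G_def)
      have "finite f" using f W finite_subset by blast
      then show "(\<Prod>i\<in>f. u i) = 0" using i zero by auto
    qed
    have sV: "sum u V = real n"
      using sum.mono_neutral_left[OF W(1) V(2), of u] zero u'(3) by auto
    then have uV: "u \<in> simplex V (real n)" using u' zero by (auto simp: simplex_def)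
    have maxV: "wval v G \<le> wval u G" if v: "v \<in> simplex V (real n)" for v
    proof -
      have v0: "\<And>i. 0 \<le> v i" using v by (auto simp: simplex_def)
      have "sum v W = sum v V"
        using v W V by (intro sum.mono_neutral_right) (auto simp: simplex_def)
      then have "v \<in> simplex W (real n)" using v V by (auto simp: simplex_def)
      then have "wval v F \<le> wval u F" by (rule max)
      moreover have "wval v G \<le> wval v F" using finF GF v0 by (intro wval_mono) auto
      ultimately show ?thesis using eq by simp
    qed
    have G: "f \<subseteq> V \<and> card f = k + 2" if "f \<in> G" for f using that W by (auto simp: G_def)
    have "wval u F \<le> real (n choose (k + 2))"
    proof (rule ccontr)
      assume "\<not> ?thesis"
      then have big: "real (n choose (k + 2)) < wval u G" using eq by simp
      have "real n * wval u (link x G) = real (k + 2) * wval u G" if "x \<in> V" for x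
      proof (rule wval_link_eq_of_max[OF GF(2) G V(1) uV maxV _ that])
        show "0 < u i" if "i \<in> V" for i using that by (simp add: V_def)
      qed
      then have "stationary (k + 2) n V G u"
        unfolding stationary_def
      proof (intro conjI ballI)
        show "G \<subseteq> [V]\<^bsup>(k + 2)\<^esup>" using G V(1) by (auto simp: nsets_def intro: finite_subset)
        show "0 < u i" if "i \<in> V" for i using that by (simp add: V_def)
      qed (use V sV big in auto)
      moreover have "card G \<le> card F" using GF finF by (simp add: card_mono)
      ultimately have "wval u G \<le> real (n choose (k + 2))" using n0[rule_format, of n V G u] n card by simp
      with big show False by simp
    qed
    with max[OF u0] show "wval u0 F \<le> real (n choose (k + 2))" by linarith
  qed
qed

section \<open>Weightings of mass 1 and their supremum\<close>

lemma weighting_le_1: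
  assumes "weighting w"
  shows "w x \<le> 1" "finite W \<Longrightarrow> sum w W \<le> 1"
proof -
  have w: "\<And>x. 0 \<le> w x" "summable w" "suminf w = 1"
    using assms by (auto simp: weighting_def sums_iff)
  show fin: "finite W \<Longrightarrow> sum w W \<le> 1" for W
    using sum_le_suminf[OF w(2)] w by metis
  show "w x \<le> 1" using fin[of "{x}"] by simp
qed

lemma uniform_weighting:
  assumes "0 < n"
  shows "weighting (\<lambda>x. if x \<in> {1..n} then 1 / real n else 0)"
proof -
  have "(\<lambda>x. if x \<in> {1..n} then 1 / real n else 0) sums (\<Sum>x\<in>{1..n}. 1 / real n)"
    by (rule sums_If_finite_set) simp
  then show ?thesis using assms by (simp add: weighting_def)
qed

lemma lagrangian_upper:
  assumes "finite G" "weighting w"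
  shows "wval w G \<le> lagrangian G"
  unfolding lagrangian_def
proof (rule cSUP_upper)
  show "bdd_above ((\<lambda>w. wval w G) ` {w. weighting w})"
  proof (rule bdd_aboveI2)
    fix w assume "w \<in> {w. weighting w}"
    then have "(\<Prod>x\<in>e. w x) \<le> 1" for e
      using weighting_le_1(1)[of w] by (intro prod_le_1) (auto simp: weighting_def)
    then have "wval w G \<le> (\<Sum>e\<in>G. 1)" unfolding wval_def by (intro sum_mono)
    then show "wval w G \<le> real (card G)" by simp
  qed
qed (use assms in simp)

lemma lagrangian_complete_ge:
  assumes "0 < n"
  shows "real (n choose r) / real n ^ r \<le> lagrangian (complete_rgraph r n)"
proof -
  let ?w = "\<lambda>x. if x \<in> {1..n} then 1 / real n else 0"
  have fin: "finite (complete_rgraph r n)" by (simp add: complete_rgraph_def)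
  have "wval ?w (complete_rgraph r n) = (\<Sum>e\<in>complete_rgraph r n. (1 / real n) ^ r)"
    unfolding wval_def
  proof (rule sum.cong[OF refl])
    fix e assume e: "e \<in> complete_rgraph r n"
    then have "(\<Prod>x\<in>e. ?w x) = (\<Prod>x\<in>e. 1 / real n)"
      by (intro prod.cong) (auto simp: complete_rgraph_def)
    then show "(\<Prod>x\<in>e. ?w x) = (1 / real n) ^ r" using e by (simp add: complete_rgraph_def)
  qed
  also have "\<dots> = real (n choose r) / real n ^ r"
    using n_subsets[of "{1..n}" r] by (simp add: complete_rgraph_def power_one_over divide_inverse power_inverse)
  finally show ?thesis
    using lagrangian_upper[OF fin uniform_weighting[OF assms]] by simp
qed

theorem theorem5p1:
  fixes r :: nat
  assumes "r \<ge> 3"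
  shows "\<exists>t0::nat. \<forall>t\<ge>t0. \<forall>G. r_graph r G \<and>
           card G = (t choose r) - ((t - 2) choose (r - 2)) \<longrightarrow>
           lagrangian G \<le> lagrangian (complete_rgraph r (t - 1))"
proof -
  define k where "k = r - 2"
  have k: "k = (r - 3) + 1" "r = k + 2" using assms by (auto simp: k_def)
  obtain n0 where n0: "\<forall>n\<ge>n0. \<forall>W F u. finite W \<and> (\<forall>f\<in>F. f \<subseteq> W \<and> card f = k + 2) \<and>
     card F \<le> (n choose (k + 2)) + ((n - 1) choose (k + 1)) \<and> u \<in> simplex W (real n) \<longrightarrow>
     wval u F \<le> real (n choose (k + 2))"
    using simplex_wval_le[OF k(1)] by (rule exE)
  show ?thesis
  proof (intro exI[of _ "n0 + 2"] allI impI)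
    fix t G
    assume t: "n0 + 2 \<le> t" and G: "r_graph r G \<and> card G = (t choose r) - ((t - 2) choose (r - 2))"
    define n where "n = t - 1"
    have n: "n0 \<le> n" "0 < n" "t = n + 1" using t by (auto simp: n_def)
    have finG: "finite G" "\<And>e. e \<in> G \<Longrightarrow> finite e \<and> card e = k + 2"
      using G k(2) by (auto simp: r_graph_def)
    have "(n + 1) choose (k + 2) = (n choose (k + 2)) + (((n - 1) choose (k + 1)) + ((n - 1) choose k))"
      using n by (cases n) auto
    then have card: "card G = (n choose (k + 2)) + ((n - 1) choose (k + 1))"
      using G n k(2) by simp
    have "wval w G \<le> real (n choose r) / real n ^ r" if w: "weighting w" for w
    proof -
      \<comment> \<open>The support of \<open>w\<close> may be infinite. Vertex 0, added to
        \<open>W\<close>, receives the mass of \<open>w\<close> outside \<open>W\<close>, which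
        cannot decrease the weight of \<open>G\<close>.\<close>
      define W where "W = insert 0 (\<Union>G)"
      have W: "finite W" "\<And>e. e \<in> G \<Longrightarrow> e \<subseteq> W" using finG by (auto simp: W_def)
      have w0: "\<And>x. 0 \<le> w x" using w by (simp add: weighting_def)
      define v where "v i = real n * (if i \<in> W then w i + (if i = 0 then 1 - sum w W else 0) else 0)" for i
      have s1: "sum w W \<le> 1" using weighting_le_1(2)[OF w W(1)] .
      have "sum v W = real n * (\<Sum>i\<in>W. w i + (if i = 0 then 1 - sum w W else 0))"
        by (simp add: v_def flip: sum_distrib_left)
      also have "\<dots> = real n" using W by (simp add: sum.distrib W_def)
      finally have "v \<in> simplex W (real n)"
        using w0 s1 by (auto simp: simplex_def v_def)
      then have "wval v G \<le> real (n choose r)"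
        using n0[rule_format, of n W G v] n W finG card k(2) by auto
      moreover have "real n ^ r * wval w G \<le> wval v G"
        unfolding wval_def sum_distrib_left
      proof (rule sum_mono)
        fix e assume e: "e \<in> G"
        have "real n ^ r * (\<Prod>i\<in>e. w i) = (\<Prod>i\<in>e. real n * w i)"
          using finG(2)[OF e] k(2) by (simp add: prod.distrib)
        also have "\<dots> \<le> (\<Prod>i\<in>e. v i)"
          using W(2)[OF e] w0 s1 by (intro prod_mono) (auto simp: v_def intro!: mult_left_mono)
        finally show "real n ^ r * (\<Prod>i\<in>e. w i) \<le> (\<Prod>i\<in>e. v i)" .
      qed
      ultimately show ?thesis using n by (simp add: pos_le_divide_eq mult.commute)
    qed
    then have "lagrangian G \<le> real (n choose r) / real n ^ r"
      unfolding lagrangian_def using uniform_weighting[OF n(2)] by (intro cSUP_least) auto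
    also have "\<dots> \<le> lagrangian (complete_rgraph r (t - 1))"
      using lagrangian_complete_ge[OF n(2)] by (simp add: n_def)
    finally show "lagrangian G \<le> lagrangian (complete_rgraph r (t - 1))" .
  qed
qed

end
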